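(* Every g-dome $G$ of base $X$ can be partitioned into a finite sequence of $n$ pyramids $P_1,\dots,P_n$ (for some $n$) with the following properties: (i) each $P_i$ has a common edge with $X$; (ii) each $G_j=G\setminus\bigcup_{i=1}^{j}P_i$ (up to closure) is a g-dome, for all $j=1,\dots,n-1$; (iii) the last pyramid $P_n$ in the sequence has the same base $X$ as $G$.
   Context: A g-dome (generalized dome) is a convex polyhedron $G\subset\mathbb{R}^3$ (a solid convex body here) with a distinguished face $X$, called its base, such that every other face of $G$ shares either an edge or a vertex with $X$; the base of each g-dome $G_j$ is again $X$. A pyramid is the convex hull of a convex polygon (its base) and one point (its apex) not in the plane of the base. A partition into pyramids means that $G$ is the union of the pyramids and their interiors are pairwise disjoint. *)

theory Defs
  imports "HOL-Analysis.Analysis"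
begin

text \<open>Polyhedra are solid: bounded, with nonempty interior in \<open>real^3\<close>.
  As usual for polyhedra, a face \<open>F\<close> below is a two-dimensional one, i.e. a facet in the
  library's terminology (its \<open>face_of\<close> also covers vertices, edges, \<open>{}\<close> and \<open>G\<close> itself).\<close>

definition convex_polyhedron3 :: "(real^3) set \<Rightarrow> bool" where
  "convex_polyhedron3 G \<longleftrightarrow> polytope G \<and> interior G \<noteq> {}"

definition common_edge :: "(real^3) set \<Rightarrow> (real^3) set \<Rightarrow> bool" where
  "common_edge S T \<longleftrightarrow> (\<exists>e. e edge_of S \<and> e edge_of T)"

definition common_vertex :: "(real^3) set \<Rightarrow> (real^3) set \<Rightarrow> bool" where
  "common_vertex S T \<longleftrightarrow> (\<exists>v. v extreme_point_of S \<and> v extreme_point_of T)"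

definition g_dome :: "(real^3) set \<Rightarrow> (real^3) set \<Rightarrow> bool" where
  "g_dome G X \<longleftrightarrow> convex_polyhedron3 G \<and> X facet_of G \<and>
     (\<forall>F. F facet_of G \<and> F \<noteq> X \<longrightarrow> common_edge F X \<or> common_vertex F X)"

definition convex_polygon :: "(real^3) set \<Rightarrow> bool" where
  "convex_polygon B \<longleftrightarrow> polytope B \<and> aff_dim B = 2"

definition pyramid_with_base :: "(real^3) set \<Rightarrow> (real^3) set \<Rightarrow> bool" where
  "pyramid_with_base P B \<longleftrightarrow> convex_polygon B \<and>
     (\<exists>a. a \<notin> affine hull B \<and> P = convex hull (insert a B))"

definition pyramid :: "(real^3) set \<Rightarrow> bool" where
  "pyramid P \<longleftrightarrow> (\<exists>B. pyramid_with_base P B)"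

definition partition_into_pyramids :: "(real^3) set \<Rightarrow> nat \<Rightarrow> (nat \<Rightarrow> (real^3) set) \<Rightarrow> bool" where
  "partition_into_pyramids G n P \<longleftrightarrow>
     (\<forall>i\<in>{1..n}. pyramid (P i)) \<and>
     G = (\<Union>i\<in>{1..n}. P i) \<and>
     (\<forall>i\<in>{1..n}. \<forall>j\<in>{1..n}. i \<noteq> j \<longrightarrow> interior (P i) \<inter> interior (P j) = {})"

end

theory Submission
  imports Defs
begin

text \<open>
  Every facet other than \<open>X\<close> touches \<open>X\<close>, and this survives when the polyhedron is cut by a plane
  through an edge of \<open>X\<close>; so only pyramids have to be produced. A piece between a facet at an edge
  \<open>l\<close> of \<open>X\<close> and a plane through \<open>l\<close> is a pyramid as soon as a single vertex \<open>w\<close> lies strictly beyond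
  the plane.

  Fix a vertex \<open>w\<close> joined to a vertex \<open>x\<close> of \<open>X\<close> by an edge, and another vertex \<open>y\<close> of \<open>X\<close> such that
  the segment \<open>wy\<close> lies in the boundary. The plane \<open>xyw\<close> splits the polyhedron, and on each side
  the facets at the edges of \<open>X\<close> are moved inwards until all of them pass through \<open>w\<close>; what remains
  is the pyramid with base \<open>X\<close> and apex \<open>w\<close>. In general consider a chord \<open>xx'\<close> of \<open>X\<close> and a vertex \<open>v\<close>
  such that \<open>vx\<close> and \<open>vx'\<close> lie in the boundary. If \<open>vy\<close> also lies in the boundary for a vertex \<open>y\<close>
  of \<open>X\<close> beyond the chord, treat the chords \<open>xy\<close> and \<open>yx'\<close> separately. Otherwise an edge \<open>vw\<close> leads
  beyond the plane \<open>vxx'\<close>, and its two facets contain \<open>x\<close> and \<open>x'\<close> respectively. Move the planes first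
  to \<open>w\<close>, by induction on the number of vertices beyond the plane; then the piece beyond a plane
  through an edge \<open>l\<close> and \<open>v\<close> is a pyramid with apex \<open>w\<close>, and after removing it the chord can be split
  at an end point of \<open>l\<close>.
\<close>

section \<open>Affine functionals on three-space\<close>

definition affine_fun :: "(real^3 \<Rightarrow> real) \<Rightarrow> bool" where
  "affine_fun f \<longleftrightarrow> (\<exists>a b. \<forall>p. f p = a \<bullet> p + b)"

lemma affine_fun_comb2:
  assumes "affine_fun f" "s + t = 1"
  shows "f (s *\<^sub>R x + t *\<^sub>R y) = s * f x + t * f y"
proof -
  obtain a b where f: "\<And>p. f p = a \<bullet> p + b" using assms(1) unfolding affine_fun_def by blast
  have "(s + t) * b = b" using assms(2) by simp
  then show ?thesis by (simp add: f inner_add_right algebra_simps)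
qed

lemma affine_fun_comb3:
  assumes "affine_fun f" "s + t + u = 1"
  shows "f (s *\<^sub>R x + t *\<^sub>R y + u *\<^sub>R z) = s * f x + t * f y + u * f z"
proof -
  obtain a b where f: "\<And>p. f p = a \<bullet> p + b" using assms(1) unfolding affine_fun_def by blast
  have "(s + t + u) * b = b" using assms(2) by simp
  then show ?thesis by (simp add: f inner_add_right algebra_simps)
qed

lemma affine_fun_comb4:
  assumes "affine_fun f" "s + t + u + r = 1"
  shows "f (s *\<^sub>R x + t *\<^sub>R y + u *\<^sub>R z + r *\<^sub>R w) = s * f x + t * f y + u * f z + r * f w"
proof -
  obtain a b where f: "\<And>p. f p = a \<bullet> p + b" using assms(1) unfolding affine_fun_def by blast
  have "(s + t + u + r) * b = b" using assms(2) by simp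
  then show ?thesis by (simp add: f inner_add_right algebra_simps)
qed

lemma affine_fun_diff_point:
  assumes "affine_fun f"
  shows "f (p + s *\<^sub>R (q - r)) = f p + s * (f q - f r)"
proof -
  obtain a b where f: "\<And>p. f p = a \<bullet> p + b" using assms(1) unfolding affine_fun_def by blast
  show ?thesis by (simp add: f inner_add_right inner_diff_right algebra_simps)
qed

lemma affine_fun_lincomb:
  assumes "affine_fun f" "affine_fun h"
  shows "affine_fun (\<lambda>p. s * f p + t * h p)"
proof -
  obtain a b where f: "\<And>p. f p = a \<bullet> p + b" using assms(1) unfolding affine_fun_def by blast
  obtain a' b' where h: "\<And>p. h p = a' \<bullet> p + b'" using assms(2) unfolding affine_fun_def by blast
  show ?thesis unfolding affine_fun_def
    by (rule exI[of _ "s *\<^sub>R a + t *\<^sub>R a'"], rule exI[of _ "s * b + t * b'"])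
      (simp add: f h inner_add_left algebra_simps)
qed

lemma affine_fun_minus: "affine_fun f \<Longrightarrow> affine_fun (\<lambda>p. - f p)"
  using affine_fun_lincomb[of f f "-1" 0] by simp

lemma affine_fun_linear:
  assumes "linear L" shows "affine_fun (\<lambda>p. L (p - q) $ i)"
  unfolding affine_fun_def
proof (intro exI allI)
  fix p
  have "L (p - q) $ i = L (p - q) \<bullet> axis i 1" by (simp add: inner_axis)
  also have "\<dots> = (p - q) \<bullet> adjoint L (axis i 1)"
    by (simp add: adjoint_works[OF assms])
  also have "\<dots> = adjoint L (axis i 1) \<bullet> p + (- (q \<bullet> adjoint L (axis i 1)))"
    by (simp add: inner_diff_left inner_commute)
  finally show "L (p - q) $ i = adjoint L (axis i 1) \<bullet> p + (- (q \<bullet> adjoint L (axis i 1)))" .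
qed

lemma affine_fun_level:
  assumes "affine_fun f"
  shows "polyhedron {p. f p \<ge> 0}" "polyhedron {p. f p \<le> 0}" "polyhedron {p. f p = 0}"
    "affine {p. f p = 0}"
proof -
  obtain a b where f: "\<And>p. f p = a \<bullet> p + b" using assms(1) unfolding affine_fun_def by blast
  have "{p. f p \<ge> 0} = {p. a \<bullet> p \<ge> - b}" "{p. f p \<le> 0} = {p. a \<bullet> p \<le> - b}"
    "{p. f p = 0} = {p. a \<bullet> p = - b}" by (auto simp: f)
  then show "polyhedron {p. f p \<ge> 0}" "polyhedron {p. f p \<le> 0}" "polyhedron {p. f p = 0}"
    "affine {p. f p = 0}"
    by (simp_all add: polyhedron_halfspace_le polyhedron_halfspace_ge polyhedron_hyperplane
        affine_hyperplane)
qed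

lemma affine_fun_level_convex:
  assumes "affine_fun f"
  shows "convex {p. f p \<ge> 0}" "convex {p. f p \<le> 0}" "convex {p. f p = 0}"
  using affine_fun_level[OF assms] polyhedron_imp_convex by blast+

lemma affine_fun_face:
  assumes "affine_fun f" "convex S" "\<And>p. p \<in> S \<Longrightarrow> 0 \<le> f p"
  shows "(S \<inter> {p. f p = 0}) face_of S"
proof -
  obtain a b where f: "\<And>p. f p = a \<bullet> p + b" using assms(1) unfolding affine_fun_def by blast
  have eq: "{p. f p = 0} = {p. a \<bullet> p = - b}" by (auto simp: f)
  show ?thesis unfolding eq
    by (rule face_of_Int_supporting_hyperplane_ge[OF assms(2)]) (use assms(3) f in force)
qed

lemma affine_fun_continuous: "affine_fun f \<Longrightarrow> continuous_on S f"
proof -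
  assume "affine_fun f"
  then obtain a b where f: "f = (\<lambda>p. a \<bullet> p + b)" unfolding affine_fun_def by blast
  show ?thesis unfolding f by (intro continuous_intros)
qed

lemma affine_fun_nonneg_hull:
  assumes "affine_fun f" "\<And>p. p \<in> S \<Longrightarrow> 0 \<le> f p" "p \<in> convex hull S"
  shows "0 \<le> f p"
proof -
  have "convex hull S \<subseteq> {p. 0 \<le> f p}"
    by (rule hull_minimal) (use assms affine_fun_level_convex in auto)
  then show ?thesis using assms(3) by auto
qed

lemma affine_fun_zero_affine_hull:
  assumes "affine_fun f" "\<And>p. p \<in> S \<Longrightarrow> f p = 0" "p \<in> affine hull S"
  shows "f p = 0"
proof -
  have "affine hull S \<subseteq> {p. f p = 0}"
    by (rule hull_minimal) (use assms affine_fun_level in auto)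
  then show ?thesis using assms(3) by auto
qed

text \<open>At an interior zero, a short step along \<open>q - p\<close> in the direction in which
  \<open>f\<close> decreases would stay in \<open>S\<close> and make \<open>f\<close>
  negative.\<close>

lemma affine_fun_interior_pos:
  assumes "affine_fun f" "\<And>p. p \<in> S \<Longrightarrow> 0 \<le> f p" "f q \<noteq> 0" "p \<in> interior S"
  shows "0 < f p"
proof -
  obtain e where e: "e > 0" "ball p e \<subseteq> S" using assms(4) mem_interior by blast
  have pS: "p \<in> S" using assms(4) interior_subset by blast
  show ?thesis
  proof (rule ccontr)
    assume "\<not> 0 < f p"
    then have p0: "f p = 0" using assms(2) pS by fastforce
    define t where "t = (if f q > 0 then -1 else 1) * (e / (2 * (1 + norm (q - p))))"
    have nn: "1 + norm (q - p) > 0" by (smt (verit) norm_ge_zero)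
    have "norm (t *\<^sub>R (q - p)) = e * (norm (q - p) / (2 * (1 + norm (q - p))))"
      unfolding t_def using e nn by (simp add: abs_mult)
    also have "\<dots> < e * 1"
      by (rule mult_strict_left_mono) (use e nn in \<open>auto simp: divide_simps intro: add_pos_nonneg\<close>)
    finally have "p + t *\<^sub>R (q - p) \<in> S" using e by (auto simp: dist_norm subset_eq)
    then have "0 \<le> f (p + t *\<^sub>R (q - p))" by (rule assms(2))
    then have "0 \<le> t * f q" using affine_fun_diff_point[OF assms(1)] p0 by simp
    moreover have "t * f q < 0"
      using assms(3) e nn unfolding t_def by (auto simp: mult_less_0_iff divide_simps zero_less_mult_iff)
    ultimately show False by simp
  qed
qed

text \<open>The functionals \<open>f1\<close>, \<open>f2\<close> witness the affine independence of the four points.\<close>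

lemma barycentric_coordinates:
  fixes a b c d :: "real^3"
  assumes f1: "affine_fun f1" "f1 a = 0" "f1 b = 0" "f1 c = 0" "f1 d \<noteq> 0"
    and f2: "affine_fun f2" "f2 a = 0" "f2 b = 0" "f2 c \<noteq> 0" and ab: "a \<noteq> b"
  obtains A B C D where "affine_fun A" "affine_fun B" "affine_fun C" "affine_fun D"
    "\<And>p. A p + B p + C p + D p = 1"
    "\<And>p. p = A p *\<^sub>R a + B p *\<^sub>R b + C p *\<^sub>R c + D p *\<^sub>R d"
    "A a = 1" "A b = 0" "A c = 0" "A d = 0" "B a = 0" "B b = 1" "B c = 0" "B d = 0"
proof -
  define T where "T = (\<lambda>s::real^3. s$1 *\<^sub>R (b - a) + s$2 *\<^sub>R (c - a) + s$3 *\<^sub>R (d - a))"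
  have linT: "linear T"
    unfolding T_def by (rule linearI) (auto simp: algebra_simps)
  have Tf: "f (a + T s) = f a + s$1 * (f b - f a) + s$2 * (f c - f a) + s$3 * (f d - f a)"
    if f: "affine_fun f" for f s
  proof -
    have eq: "a + T s = a + s$1 *\<^sub>R (b - a) + s$2 *\<^sub>R (c - a) + s$3 *\<^sub>R (d - a)"
      by (simp add: T_def)
    show ?thesis unfolding eq by (simp add: affine_fun_diff_point[OF f])
  qed
  \<comment> \<open>Triangular elimination: \<open>f1\<close> isolates the coefficient of
    \<open>d - a\<close>, then \<open>f2\<close> that of \<open>c - a\<close>, and
    \<open>a \<noteq> b\<close> gives the last.\<close>
  have "s = 0" if "T s = 0" for s
  proof -
    have s3: "s$3 = 0" using Tf[OF f1(1), of s] f1 that by simp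
    have s2: "s$2 = 0" using Tf[OF f2(1), of s] f2 that s3 by simp
    have "s$1 *\<^sub>R (b - a) = 0" using that s2 s3 by (simp add: T_def)
    then have "s$1 = 0" using ab by simp
    then show ?thesis using s2 s3 by (simp add: vec_eq_iff forall_3)
  qed
  then have inj: "inj T" using linear_injective_0[OF linT] by blast
  then obtain L where L: "linear L" "\<And>s. L (T s) = s" "\<And>p. T (L p) = p"
    using linear_injective_isomorphism[OF linT inj] by blast
  define B where "B = (\<lambda>p. L (p - a) $ 1)"
  define C where "C = (\<lambda>p. L (p - a) $ 2)"
  define D where "D = (\<lambda>p. L (p - a) $ 3)"
  define A where "A = (\<lambda>p. 1 - B p - C p - D p)"
  have aff: "affine_fun B" "affine_fun C" "affine_fun D"
    unfolding B_def C_def D_def by (rule affine_fun_linear[OF L(1)])+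
  have one: "affine_fun (\<lambda>p. 1)" unfolding affine_fun_def
    by (rule exI[of _ 0], rule exI[of _ 1]) simp
  have affA: "affine_fun A"
  proof -
    have "affine_fun (\<lambda>p. 1 * (1 * (1 * 1 + (-1) * B p) + (-1) * C p) + (-1) * D p)"
      by (intro affine_fun_lincomb aff one)
    then show ?thesis unfolding A_def by (simp add: algebra_simps)
  qed
  have dec: "p = A p *\<^sub>R a + B p *\<^sub>R b + C p *\<^sub>R c + D p *\<^sub>R d" for p
  proof -
    have "p = a + T (L (p - a))" using L(3) by simp
    then show ?thesis unfolding T_def A_def B_def C_def D_def by (simp add: algebra_simps)
  qed
  have Lb: "L (b - a) = axis 1 1"
    using L(2)[of "axis 1 1"] by (simp add: T_def axis_def)
  have Lc: "L (c - a) = axis 2 1"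
    using L(2)[of "axis 2 1"] by (simp add: T_def axis_def)
  have Ld: "L (d - a) = axis 3 1"
    using L(2)[of "axis 3 1"] by (simp add: T_def axis_def)
  have La: "L (a - a) = 0" using L(1) by (simp add: linear_0)
  show thesis
    by (rule that[OF affA aff _ dec])
      (use La Lb Lc Ld in \<open>simp_all add: A_def B_def C_def D_def axis_def\<close>)
qed

text \<open>Normalising the part without \<open>d\<close> gives a point \<open>m\<close> of
  \<open>S\<close> with \<open>z\<close> between \<open>m\<close> and \<open>d\<close>; extremality
  leaves only the degenerate case.\<close>

lemma extreme_point_not_comb3:
  assumes ext: "z extreme_point_of S" and S: "convex S" and mem: "a \<in> S" "b \<in> S" "d \<in> S"
    and z: "z = s *\<^sub>R a + t *\<^sub>R b + u *\<^sub>R d" and st: "0 \<le> s" "0 \<le> t" "0 < u" "s + t + u = 1"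
  shows "d = z"
proof (cases "u = 1")
  case True
  then show ?thesis using z st by (simp add: add_nonneg_eq_0_iff)
next
  case False
  define m where "m = (s / (1 - u)) *\<^sub>R a + (t / (1 - u)) *\<^sub>R b"
  have u1: "1 - u > 0" using False st by linarith
  have "m \<in> S" unfolding m_def
    by (rule convexD[OF S mem(1,2)]) (use u1 st in \<open>auto simp: add_divide_distrib[symmetric]\<close>)
  have "z = (1 - u) *\<^sub>R m + u *\<^sub>R d" unfolding m_def z using u1 by (simp add: scaleR_add_right)
  show ?thesis
  proof (rule ccontr)
    assume "d \<noteq> z"
    then have "m \<noteq> d" using \<open>z = (1 - u) *\<^sub>R m + u *\<^sub>R d\<close>
      by (metis add.commute diff_add_cancel scaleR_left_distrib scaleR_one)
    then have "z \<in> open_segment m d"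
      unfolding in_segment using \<open>z = (1 - u) *\<^sub>R m + u *\<^sub>R d\<close> u1 st by auto
    then show False using ext \<open>m \<in> S\<close> mem(3) unfolding extreme_point_of_def by blast
  qed
qed

lemma extreme_point_not_comb2:
  assumes ext: "z extreme_point_of S" and S: "convex S" and mem: "a \<in> S" "b \<in> S"
    and z: "z = s *\<^sub>R a + t *\<^sub>R b" and st: "0 \<le> s" "0 < t" "s + t = 1"
  shows "b = z"
  using extreme_point_not_comb3[OF ext S mem(1,1,2), of s 0 t] z st by simp

lemma extreme_point_of_subset:
  "z extreme_point_of S \<Longrightarrow> T \<subseteq> S \<Longrightarrow> z \<in> T \<Longrightarrow> z extreme_point_of T"
  unfolding extreme_point_of_def by blast

section \<open>The base polygon and its chords\<close>

text \<open>The data that no cut changes: the base \<open>X\<close> in the plane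
  \<open>g = 0\<close> and functionals \<open>L\<close> for its edges. The polyhedron stays variable
  because the cuts replace it by smaller ones.\<close>

locale dome_base =
  fixes X :: "(real^3) set" and g :: "real^3 \<Rightarrow> real" and L :: "(real^3 \<Rightarrow> real) set"
  assumes affine_g: "affine_fun g" and g_pos: "\<exists>p. 0 < g p"
    and polytope_X: "polytope X" and aff_dim_X: "aff_dim X = 2"
    and finite_L: "finite L" and affine_L: "\<And>l. l \<in> L \<Longrightarrow> affine_fun l"
    and X_eq: "X = {q. g q = 0 \<and> (\<forall>l\<in>L. 0 \<le> l q)}"
    and edge_L: "\<And>l. l \<in> L \<Longrightarrow> (X \<inter> {q. l q = 0}) edge_of X"
    and pos_L: "\<And>l. l \<in> L \<Longrightarrow> \<exists>q\<in>X. 0 < l q"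
begin

text \<open>The plane \<open>tilt c v = 0\<close> passes through \<open>v\<close> and the trace of \<open>c = 0\<close> on the base plane
  \<open>g = 0\<close>.\<close>

definition tilt :: "(real^3 \<Rightarrow> real) \<Rightarrow> real^3 \<Rightarrow> real^3 \<Rightarrow> real" where
  "tilt c v = (\<lambda>p. c p - c v / g v * g p)"

text \<open>The sign of \<open>c\<close> orients the chord: points with \<open>c < 0\<close> count
  as beyond it. The last conjunct makes the trace of \<open>c\<close> on the base plane a
  line.\<close>

definition chord :: "(real^3 \<Rightarrow> real) \<Rightarrow> real^3 \<Rightarrow> real^3 \<Rightarrow> bool" where
  "chord c x y \<longleftrightarrow> affine_fun c \<and> x extreme_point_of X \<and> y extreme_point_of X \<and> x \<noteq> y \<and>
     c x = 0 \<and> c y = 0 \<and> (\<exists>z\<in>X. c z \<noteq> 0)"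

text \<open>The second alternative covers a chord that is itself an edge, with \<open>X\<close> on the side \<open>c \<ge> 0\<close>.\<close>

definition arc_edges :: "(real^3 \<Rightarrow> real) \<Rightarrow> (real^3 \<Rightarrow> real) set" where
  "arc_edges c = {l\<in>L. (\<exists>b\<in>X. l b = 0 \<and> c b < 0) \<or> (\<forall>q\<in>X. 0 \<le> c q) \<and> (\<forall>b\<in>X. l b = 0 \<longrightarrow> c b = 0)}"

lemma g_X: "q \<in> X \<Longrightarrow> g q = 0"
  using X_eq by blast

lemma L_nonneg: "l \<in> L \<Longrightarrow> q \<in> X \<Longrightarrow> 0 \<le> l q"
  using X_eq by blast

lemma convex_X: "convex X" and compact_X: "compact X" and bounded_X: "bounded X"
  using polytope_X polytope_imp_convex polytope_imp_compact polytope_imp_bounded by blast+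

lemma extreme_in_X: "z extreme_point_of X \<Longrightarrow> z \<in> X"
  by (simp add: extreme_point_of_def)

lemma finite_extreme_X: "finite {z. z extreme_point_of X}"
  by (simp add: finite_polyhedron_extreme_points polytope_X polytope_imp_polyhedron)

lemma affine_tilt: "affine_fun c \<Longrightarrow> affine_fun (tilt c v)"
  using affine_fun_lincomb[OF _ affine_g, of c 1 "- (c v / g v)"] unfolding tilt_def by simp

lemma tilt_base: "g q = 0 \<Longrightarrow> tilt c v q = c q"
  by (simp add: tilt_def)

lemma tilt_self: "g v \<noteq> 0 \<Longrightarrow> tilt c v v = 0"
  by (simp add: tilt_def)

lemma tilt_swap: "g v \<noteq> 0 \<Longrightarrow> g w \<noteq> 0 \<Longrightarrow> tilt c w v = - (g v / g w) * tilt c v w"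
  by (simp add: tilt_def field_simps)

lemma chordD:
  assumes "chord c x y"
  shows "affine_fun c" "x extreme_point_of X" "y extreme_point_of X" "x \<noteq> y"
     "c x = 0" "c y = 0" "x \<in> X" "y \<in> X" "\<exists>z\<in>X. c z \<noteq> 0"
  using assms extreme_in_X unfolding chord_def by auto

lemma chord_sym: "chord c x y \<Longrightarrow> chord c y x"
  unfolding chord_def by auto

section \<open>Edges, chords and arcs of the base\<close>

lemma edge_two_points:
  assumes "l \<in> L"
  obtains a b where "a \<in> X" "b \<in> X" "a \<noteq> b" "l a = 0" "l b = 0"
proof -
  let ?e = "X \<inter> {q. l q = 0}"
  have d: "aff_dim ?e = 1" using edge_L[OF assms] unfolding edge_of_def by simp
  have "\<not> ?e \<subseteq> {a}" for a
  proof
    assume "?e \<subseteq> {a}"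
    then have "aff_dim ?e \<le> aff_dim {a}" by (rule aff_dim_subset)
    then show False using d by simp
  qed
  moreover obtain a where "a \<in> ?e" using d by (metis aff_dim_empty all_not_in_conv zero_neq_neg_one one_neq_neg_one)
  ultimately show thesis using that by blast
qed

text \<open>The edge is the convex hull of its extreme points, and these are vertices of
  \<open>X\<close>.\<close>

lemma edge_nonneg_if_extreme:
  assumes l: "l \<in> L" and c: "affine_fun c"
    and nn: "\<And>z. z extreme_point_of X \<Longrightarrow> l z = 0 \<Longrightarrow> 0 \<le> c z" and b: "b \<in> X" "l b = 0"
  shows "0 \<le> c b"
proof -
  let ?e = "X \<inter> {q. l q = 0}"
  have f: "?e face_of X" using edge_L[OF l] unfolding edge_of_def by simp
  have "compact ?e" "convex ?e"
    using f compact_X convex_X face_of_imp_compact face_of_imp_convex by blast+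
  then have "?e = convex hull {z. z extreme_point_of ?e}" by (rule Krein_Milman_Minkowski)
  then have "b \<in> convex hull {z. z extreme_point_of ?e}" using b by auto
  then show ?thesis
    by (rule affine_fun_nonneg_hull[OF c, rotated])
      (use nn extreme_point_of_face[OF f] in auto)
qed

lemma edge_extreme:
  assumes l: "l \<in> L"
  obtains z where "z extreme_point_of X" "l z = 0"
proof (rule ccontr)
  assume "\<not> thesis"
  then have none: "\<And>z. z extreme_point_of X \<Longrightarrow> l z \<noteq> 0" using that by blast
  obtain b where b: "b \<in> X" "l b = 0" using edge_two_points[OF l] by blast
  \<comment> \<open>Without vertices on the edge, even the constant \<open>-1\<close> would satisfy
    the nonnegativity criterion vacuously.\<close>
  have "affine_fun (\<lambda>p. - 1)" unfolding affine_fun_def by (rule exI[of _ 0]) auto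
  from edge_nonneg_if_extreme[OF l this _ b] none show False by force
qed

text \<open>In barycentric coordinates for \<open>a\<close>, \<open>b\<close>, \<open>z\<close>,
  \<open>v\<close> both functionals are multiples of the coordinate of \<open>z\<close>, since they
  vanish at the other three points.\<close>

lemma tilt_unique:
  assumes ab: "a \<in> X" "b \<in> X" "a \<noteq> b" and c: "affine_fun c" "c a = 0" "c b = 0"
    and z: "z \<in> X" "c z \<noteq> 0" and v: "g v \<noteq> 0"
    and f: "affine_fun f" "f a = 0" "f b = 0" "f v = 0"
  shows "f p = f z / c z * tilt c v p"
proof -
  obtain A B C D where co: "\<And>p. A p + B p + C p + D p = (1::real)"
    "\<And>p. p = A p *\<^sub>R a + B p *\<^sub>R b + C p *\<^sub>R z + D p *\<^sub>R v"
    using barycentric_coordinates[OF affine_g g_X[OF ab(1)] g_X[OF ab(2)] g_X[OF z(1)] v c z(2) ab(3)]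
    by metis
  have "f p = f (A p *\<^sub>R a + B p *\<^sub>R b + C p *\<^sub>R z + D p *\<^sub>R v)" using co(2) by metis
  then have 1: "f p = C p * f z" using affine_fun_comb4[OF f(1) co(1)] f by simp
  have "tilt c v p = tilt c v (A p *\<^sub>R a + B p *\<^sub>R b + C p *\<^sub>R z + D p *\<^sub>R v)" using co(2) by metis
  then have "tilt c v p = C p * c z"
    using affine_fun_comb4[OF affine_tilt[OF c(1)] co(1)] c z ab
    by (simp add: tilt_base g_X tilt_self[OF v])
  then show ?thesis using 1 z by simp
qed

text \<open>Barycentric coordinates of the base plane for the triangle \<open>x x' y\<close>,
  obtained from spatial ones by adding a point \<open>v\<close> off the plane, whose coordinate
  vanishes where \<open>g = 0\<close>.\<close>

lemma plane_coordinates: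
  assumes c: "chord c x x'" and y: "y \<in> X" "c y \<noteq> 0"
  obtains c1 c2 where "affine_fun c1" "affine_fun c2" "c1 x = 0" "c1 y = 0" "c1 x' = 1"
    "c2 x = 1" "c2 y = 0" "c2 x' = 0"
    "\<And>b. g b = 0 \<Longrightarrow> b = c2 b *\<^sub>R x + c1 b *\<^sub>R x' + (c b / c y) *\<^sub>R y"
    "\<And>b. g b = 0 \<Longrightarrow> c2 b + c1 b + c b / c y = 1"
proof -
  obtain v where v: "g v \<noteq> 0" using g_pos by force
  note cd = chordD[OF c]
  obtain A B C D where co: "affine_fun A" "affine_fun B" "\<And>p. A p + B p + C p + D p = (1::real)"
    "\<And>p. p = A p *\<^sub>R x + B p *\<^sub>R x' + C p *\<^sub>R y + D p *\<^sub>R v"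
    "A x = 1" "A x' = 0" "A y = 0" "B x = 0" "B x' = 1" "B y = 0"
    using barycentric_coordinates[OF affine_g g_X[OF cd(7)] g_X[OF cd(8)] g_X[OF y(1)] v
        cd(1) cd(5) cd(6) y(2) cd(4)]
    by metis
  have D0: "D b = 0" and Cb: "C b = c b / c y" if "g b = 0" for b
  proof -
    have "g b = g (A b *\<^sub>R x + B b *\<^sub>R x' + C b *\<^sub>R y + D b *\<^sub>R v)" using co(4) by metis
    then show D: "D b = 0"
      using affine_fun_comb4[OF affine_g co(3)] g_X cd y v that by simp
    have "c b = c (A b *\<^sub>R x + B b *\<^sub>R x' + C b *\<^sub>R y + D b *\<^sub>R v)" using co(4) by metis
    also have "\<dots> = C b * c y" unfolding affine_fun_comb4[OF cd(1) co(3)] using cd D by simp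
    finally show "C b = c b / c y" using y by simp
  qed
  have "b = A b *\<^sub>R x + B b *\<^sub>R x' + (c b / c y) *\<^sub>R y" if "g b = 0" for b
    using co(4)[of b] D0[OF that] Cb[OF that] by simp
  moreover have "A b + B b + c b / c y = 1" if "g b = 0" for b
    using co(3)[of b] D0[OF that] Cb[OF that] by simp
  ultimately show thesis by (intro that[of B A] co)
qed

text \<open>A point of \<open>X\<close> on the line \<open>xx'\<close> with a negative coefficient
  would put one of the two ends strictly between points of \<open>X\<close>.\<close>

lemma chord_point:
  assumes c: "chord c x x'" and r: "r \<in> X" "c r = 0"
  obtains s t where "0 \<le> s" "0 \<le> t" "s + t = (1::real)" "r = s *\<^sub>R x + t *\<^sub>R x'"
proof -
  note cd = chordD[OF c]
  obtain y where y: "y \<in> X" "c y \<noteq> 0" using cd(9) by blast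
  obtain c1 c2 where co: "\<And>b. g b = 0 \<Longrightarrow> b = c2 b *\<^sub>R x + c1 b *\<^sub>R x' + (c b / c y) *\<^sub>R y"
    "\<And>b. g b = 0 \<Longrightarrow> c2 b + c1 b + c b / c y = (1::real)"
    using plane_coordinates[OF c y] by metis
  define s t where "s = c2 r" and "t = c1 r"
  have req: "r = s *\<^sub>R x + t *\<^sub>R x'" and st: "s + t = 1"
    using co(1)[OF g_X[OF r(1)]] co(2)[OF g_X[OF r(1)]] r(2) by (simp_all add: s_def t_def)
  have key: False if "s < 0" "s + t = 1" "r = s *\<^sub>R a + t *\<^sub>R b" "a \<in> X" "b extreme_point_of X" "a \<noteq> b"
    for s t a b
  proof -
    have t: "t > 1" using that by linarith
    have "b = (1 / t) *\<^sub>R r + (- s / t) *\<^sub>R a" using t that(3) by (simp add: algebra_simps)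
    moreover have "1 / t + (- s / t) = 1" using that(1,2) t by (simp add: field_simps)
    ultimately have "a = b"
      using extreme_point_not_comb2[OF that(5) convex_X r(1) that(4), of "1/t" "-s/t"] t that(1)
      by (simp add: divide_neg_pos)
    then show False using that(6) by simp
  qed
  have "0 \<le> s" using key[of s t x x'] req st cd by force
  moreover have "0 \<le> t" using key[of t s x' x] req st cd by (force simp: add.commute)
  ultimately show thesis using that st req by blast
qed

lemma chord_extreme:
  assumes c: "chord c x x'" and z: "z extreme_point_of X" "c z = 0"
  shows "z = x \<or> z = x'"
proof -
  obtain s t where st: "0 \<le> s" "0 \<le> t" "s + t = (1::real)" "z = s *\<^sub>R x + t *\<^sub>R x'"
    using chord_point[OF c extreme_in_X[OF z(1)] z(2)] by blast
  show ?thesis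
  proof (cases "t > 0")
    case True
    then show ?thesis
      using extreme_point_not_comb2[OF z(1) convex_X _ _ st(4,1) True st(3)] chordD[OF c] by auto
  next
    case False
    then show ?thesis using st by simp
  qed
qed

text \<open>On the way from \<open>a\<close> to \<open>p\<close>, \<open>X\<close> is left at the
  first edge line reached among those that have \<open>p\<close> on the wrong side.\<close>

lemma exit_point:
  assumes a: "a \<in> X" and p: "g p = 0" "p \<notin> X"
  obtains t l where "0 \<le> t" "t < (1::real)" "a + t *\<^sub>R (p - a) \<in> X" "l \<in> L"
    "l (a + t *\<^sub>R (p - a)) = 0" "l p < 0"
proof -
  define M where "M = {l\<in>L. l p < 0}"
  \<comment> \<open>\<open>T l\<close> is the parameter at which \<open>l\<close> vanishes on the
    way; its minimum over \<open>M\<close> is the exit time.\<close>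
  define T where "T = (\<lambda>l::real^3 \<Rightarrow> real. l a / (l a - l p))"
  have "finite M" "M \<noteq> {}" using finite_L p X_eq unfolding M_def by (auto simp: not_le)
  then obtain l where l: "l \<in> M" "\<And>m. m \<in> M \<Longrightarrow> T l \<le> T m"
    using ex_is_arg_min_if_finite[of M T] unfolding is_arg_min_linorder by auto
  define t where "t = T l"
  define b where "b = a + t *\<^sub>R (p - a)"
  have lL: "l \<in> L" "l p < 0" "0 \<le> l a" using l a L_nonneg unfolding M_def by auto
  have t: "0 \<le> t" "t < 1" unfolding t_def T_def using lL by (auto simp: field_simps)
  have ev: "f b = f a + t * (f p - f a)" if "affine_fun f" for f
    unfolding b_def by (rule affine_fun_diff_point[OF that])
  have "0 \<le> m b" if m: "m \<in> L" for m
  proof (cases "m p < 0")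
    case True
    then have "t \<le> T m" using l(2) m unfolding t_def M_def by simp
    moreover have "m a - m p > 0" using L_nonneg[OF m a] True by linarith
    ultimately have "t * (m a - m p) \<le> m a" unfolding T_def by (simp add: field_simps)
    then show ?thesis using ev[OF affine_L[OF m]] by (simp add: algebra_simps)
  next
    case False
    have "m b = (1 - t) * m a + t * m p" using ev[OF affine_L[OF m]] by (simp add: algebra_simps)
    then show ?thesis using False t L_nonneg[OF m a] by simp
  qed
  moreover have "g b = 0" using ev[OF affine_g] p g_X[OF a] by simp
  ultimately have "b \<in> X" using X_eq by blast
  moreover have "l b = 0"
    using ev[OF affine_L[OF lL(1)]] lL unfolding t_def T_def by (simp add: field_simps)
  ultimately show thesis using that[OF t _ lL(1)] lL unfolding b_def by blast
qed

text \<open>The chord line is the line of the edge, so the tilted functionals are proportional, with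
  one factor for every apex \<open>v\<close>.\<close>

lemma chord_edge_unique:
  assumes c: "affine_fun c" "\<exists>z\<in>X. c z \<noteq> 0" and l: "l \<in> L"
    and ab: "a \<in> X" "b \<in> X" "a \<noteq> b" "c a = 0" "c b = 0" "l a = 0" "l b = 0"
  shows "\<exists>k. k \<noteq> 0 \<and> (\<forall>v p. g v \<noteq> 0 \<longrightarrow> tilt l v p = k * tilt c v p)"
proof -
  obtain z where z: "z \<in> X" "c z \<noteq> 0" using c(2) by blast
  have e: "tilt l v p = l z / c z * tilt c v p" if "g v \<noteq> 0" for v p
    using tilt_unique[OF ab(1-3) c(1) ab(4,5) z that affine_tilt[OF affine_L[OF l]], of v p] ab z that
    by (simp add: tilt_base g_X tilt_self)
  obtain v where v: "g v \<noteq> 0" using g_pos by force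
  obtain q where q: "q \<in> X" "0 < l q" using pos_L[OF l] by blast
  have "l q = l z / c z * c q" using e[OF v, of q] q by (simp add: tilt_base g_X)
  then have "l z / c z \<noteq> 0" using q by auto
  then show ?thesis using e by blast
qed

text \<open>If \<open>p\<close> were outside \<open>X\<close>, a segment from a point of
  \<open>X\<close> beyond the chord to \<open>p\<close> would leave \<open>X\<close> beyond the
  chord, hence through an arc edge, on whose wrong side \<open>p\<close> would lie.\<close>

lemma arc_region:
  assumes c: "chord c x x'" and p: "g p = 0" "c p < 0" "\<And>l. l \<in> arc_edges c \<Longrightarrow> 0 \<le> l p"
  shows "p \<in> X"
proof (rule ccontr)
  assume pX: "p \<notin> X"
  note cd = chordD[OF c]
  have ev: "c (a + t *\<^sub>R (p - a)) = (1 - t) * c a + t * c p" for a t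
    using affine_fun_diff_point[OF cd(1)] by (simp add: algebra_simps)
  show False
  proof (cases "\<exists>a\<in>X. c a < 0")
    case True
    then obtain a where a: "a \<in> X" "c a < 0" by blast
    obtain t l where t: "0 \<le> t" "t < (1::real)" "a + t *\<^sub>R (p - a) \<in> X" "l \<in> L"
      "l (a + t *\<^sub>R (p - a)) = 0" "l p < 0"
      using exit_point[OF a(1) p(1) pX] by blast
    have "(1 - t) * c a < 0" "t * c p \<le> 0" using t a p by (auto simp: mult_pos_neg mult_nonneg_nonpos)
    then have "c (a + t *\<^sub>R (p - a)) < 0" unfolding ev by linarith
    then have "l \<in> arc_edges c" using t unfolding arc_edges_def by blast
    then show False using p(3) t(6) by force
  next
    case False
    then have nn: "\<forall>q\<in>X. 0 \<le> c q" by force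
    \<comment> \<open>No point of \<open>X\<close> lies beyond the chord, so a segment from the
      midpoint of the chord leaves \<open>X\<close> at once, and the exit edge lies on the
      chord.\<close>
    define a where "a = (1/2) *\<^sub>R x + (1/2) *\<^sub>R x'"
    have a: "a \<in> X" unfolding a_def by (rule convexD[OF convex_X]) (use cd in auto)
    have ca: "c a = 0" unfolding a_def using affine_fun_comb2[OF cd(1)] cd by simp
    obtain t l where t: "0 \<le> t" "t < (1::real)" "a + t *\<^sub>R (p - a) \<in> X" "l \<in> L"
      "l (a + t *\<^sub>R (p - a)) = 0" "l p < 0"
      using exit_point[OF a(1) p(1) pX] by blast
    have "0 \<le> t * c p" using nn t(3) ev[of a t] ca by auto
    then have "t = 0" using t p(2) by (simp add: zero_le_mult_iff)
    then have "l a = 0" using t by simp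
    then have "l x + l x' = 0" unfolding a_def using affine_fun_comb2[OF affine_L[OF t(4)]] by simp
    then have lx: "l x = 0" "l x' = 0"
      using L_nonneg[OF t(4) cd(7)] L_nonneg[OF t(4) cd(8)] by linarith+
    obtain k where k: "k \<noteq> 0" "\<forall>v p. g v \<noteq> 0 \<longrightarrow> tilt l v p = k * tilt c v p"
      using chord_edge_unique[OF cd(1,9) t(4) cd(7,8,4,5,6) lx] by blast
    obtain v where v: "g v \<noteq> 0" using g_pos by force
    have "c b = 0" if "b \<in> X" "l b = 0" for b
      using k v that by (metis g_X mult_eq_0_iff tilt_base)
    then have "l \<in> arc_edges c" using t(4) nn unfolding arc_edges_def by blast
    then show False using p(3) t(6) by force
  qed
qed

text \<open>Splitting a chord \<open>xx'\<close> at a vertex \<open>y\<close> beyond it: \<open>c1\<close> and \<open>c2\<close> are the barycentric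
  coordinates of \<open>x'\<close> and \<open>x\<close> in the triangle \<open>x x' y\<close>.\<close>

context
  fixes c c1 c2 :: "real^3 \<Rightarrow> real" and x x' y :: "real^3"
  assumes ch: "chord c x x'" and y: "y extreme_point_of X" "c y < 0"
    and aff1: "affine_fun c1" and aff2: "affine_fun c2"
    and vals: "c1 x = 0" "c1 y = 0" "c1 x' = 1" "c2 x = 1" "c2 y = 0" "c2 x' = 0"
    and decomp: "\<And>b. g b = 0 \<Longrightarrow> b = c2 b *\<^sub>R x + c1 b *\<^sub>R x' + (c b / c y) *\<^sub>R y"
    and sum1: "\<And>b. g b = 0 \<Longrightarrow> c2 b + c1 b + c b / c y = (1::real)"
begin

lemma split_chords: "chord c1 x y" "chord c2 y x'"
proof -
  note cd = chordD[OF ch]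
  have "x \<noteq> y" "x' \<noteq> y" using cd y by auto
  moreover have "\<exists>z\<in>X. c1 z \<noteq> 0" "\<exists>z\<in>X. c2 z \<noteq> 0" using cd(7,8) vals by force+
  ultimately show "chord c1 x y" "chord c2 y x'"
    unfolding chord_def using aff1 aff2 vals cd y by auto
qed

text \<open>If \<open>b\<close> were not beyond \<open>xx'\<close>, solving its decomposition for
  \<open>x\<close> would write \<open>x\<close> as a convex combination of \<open>b\<close>,
  \<open>y\<close>, \<open>x'\<close> with positive weight on \<open>x'\<close>.\<close>

lemma split_beyond1:
  assumes b: "b \<in> X" "c1 b < 0" shows "c b < 0"
proof (rule ccontr)
  assume "\<not> c b < 0"
  then have ly: "c b / c y \<le> 0" using y by (simp add: divide_nonneg_neg)
  note cd = chordD[OF ch]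
  have g0: "g b = 0" using b g_X by blast
  define s where "s = c2 b"
  have s: "s > 1" using sum1[OF g0] ly b unfolding s_def by linarith
  have "s *\<^sub>R x = b + (- (c b / c y)) *\<^sub>R y + (- c1 b) *\<^sub>R x'"
    using decomp[OF g0] unfolding s_def by (simp add: algebra_simps)
  then have "(1/s) *\<^sub>R (s *\<^sub>R x) = (1/s) *\<^sub>R (b + (- (c b / c y)) *\<^sub>R y + (- c1 b) *\<^sub>R x')" by simp
  then have "x = (1/s) *\<^sub>R b + (- (c b / c y) / s) *\<^sub>R y + (- c1 b / s) *\<^sub>R x'"
    using s by (simp add: algebra_simps)
  moreover have "1/s + (- (c b / c y) / s) + (- c1 b / s) = 1"
  proof -
    have "1/s + (- (c b / c y) / s) + (- c1 b / s) = (1 - c b / c y - c1 b) / s"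
      by (simp add: diff_divide_distrib)
    also have "1 - c b / c y - c1 b = s" using sum1[OF g0] unfolding s_def by linarith
    finally show ?thesis using s by simp
  qed
  moreover have "0 \<le> - (c b / c y) / s" "0 < - c1 b / s" "0 \<le> 1/s"
    using divide_nonneg_pos[of "- (c b / c y)" s] divide_pos_pos[of "- c1 b" s] ly b s by simp_all
  ultimately have "x' = x"
    using extreme_point_not_comb3[OF cd(2) convex_X b(1) extreme_in_X[OF y(1)] cd(8)] by blast
  then show False using cd(4) by simp
qed

lemma split_arc1: "arc_edges c1 \<subseteq> arc_edges c"
proof
  fix l assume l: "l \<in> arc_edges c1"
  then have lL: "l \<in> L" unfolding arc_edges_def by blast
  note cd = chordD[OF ch]
  consider b where "b \<in> X" "l b = 0" "c1 b < 0" | "\<forall>b\<in>X. l b = 0 \<longrightarrow> c1 b = 0"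
    using l unfolding arc_edges_def by blast
  then show "l \<in> arc_edges c"
  proof cases
    case 1
    then show ?thesis using split_beyond1 lL unfolding arc_edges_def by blast
  next
    case 2
    \<comment> \<open>The edge lies on the chord \<open>xy\<close>; any of its points other than
      \<open>x\<close> has positive weight on \<open>y\<close> and so lies beyond
      \<open>xx'\<close>.\<close>
    obtain a b where ab: "a \<in> X" "b \<in> X" "a \<noteq> b" "l a = 0" "l b = 0"
      using edge_two_points[OF lL] by blast
    obtain d where d: "d \<in> X" "l d = 0" "d \<noteq> x" using ab by blast
    obtain s t where st: "0 \<le> s" "0 \<le> t" "s + t = (1::real)" "d = s *\<^sub>R x + t *\<^sub>R y"
      using chord_point[OF split_chords(1) d(1)] 2 d by blast
    have "t > 0" using st d(3) by (cases "t = 0") auto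
    moreover have "c d = t * c y" using affine_fun_comb2[OF cd(1) st(3)] st(4) cd by simp
    ultimately have "c d < 0" using y by (simp add: mult_pos_neg)
    then show ?thesis using d lL unfolding arc_edges_def by blast
  qed
qed

text \<open>On \<open>X\<close>, \<open>l\<close> is a multiple of \<open>c1\<close>, and
  \<open>c1 x' = 1\<close> makes the factor positive; so the second alternative of
  \<open>arc_edges\<close> applies.\<close>

lemma edge_on_side:
  assumes l: "l \<in> L" "l x = 0" "l y = 0" shows "l \<in> arc_edges c1"
proof -
  note c1d = chordD[OF split_chords(1)]
  obtain k where k: "k \<noteq> 0" "\<forall>v p. g v \<noteq> 0 \<longrightarrow> tilt l v p = k * tilt c1 v p"
    using chord_edge_unique[OF c1d(1,9) l(1) c1d(7,8,4,5,6) l(2,3)] by blast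
  obtain v where v: "g v \<noteq> 0" using g_pos by force
  have e: "l q = k * c1 q" if "q \<in> X" for q using k v that by (metis g_X tilt_base)
  have x': "x' \<in> X" using chordD[OF ch] by blast
  have "k \<ge> 0" using e[OF x'] vals L_nonneg[OF l(1) x'] by simp
  then have "k > 0" using k by simp
  have "\<forall>q\<in>X. 0 \<le> c1 q"
  proof
    fix q assume q: "q \<in> X"
    have "0 \<le> k * c1 q" using e[OF q] L_nonneg[OF l(1) q] by simp
    then show "0 \<le> c1 q" using \<open>k > 0\<close> by (simp add: zero_le_mult_iff)
  qed
  moreover have "\<forall>b\<in>X. l b = 0 \<longrightarrow> c1 b = 0" using e k by auto
  ultimately show ?thesis using l unfolding arc_edges_def by blast
qed

end

text \<open>An edge beyond \<open>xx'\<close> that reaches beyond neither new chord has a point in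
  the triangle \<open>x x' y\<close>; nonnegativity of \<open>l\<close> then forces the edge onto
  the side \<open>xy\<close> or \<open>yx'\<close>.\<close>

lemma arc_split:
  assumes ch: "chord c x x'" and y: "y extreme_point_of X" "c y < 0"
    and aff: "affine_fun c1" "affine_fun c2"
    and vals: "c1 x = 0" "c1 y = 0" "c1 x' = 1" "c2 x = 1" "c2 y = 0" "c2 x' = 0"
    and decomp: "\<And>b. g b = 0 \<Longrightarrow> b = c2 b *\<^sub>R x + c1 b *\<^sub>R x' + (c b / c y) *\<^sub>R y"
    and sum1: "\<And>b. g b = 0 \<Longrightarrow> c2 b + c1 b + c b / c y = (1::real)"
  shows "arc_edges c = arc_edges c1 \<union> arc_edges c2" "\<And>b. b \<in> X \<Longrightarrow> c1 b < 0 \<Longrightarrow> c b < 0"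
    "\<And>b. b \<in> X \<Longrightarrow> c2 b < 0 \<Longrightarrow> c b < 0" "chord c1 x y" "chord c2 y x'"
proof -
  \<comment> \<open>The hypotheses are symmetric under exchanging \<open>x\<close> with
    \<open>x'\<close> and \<open>c1\<close> with \<open>c2\<close>; \<open>A\<close> and
    \<open>B\<close> collect the two versions.\<close>
  have decomp': "\<And>b. g b = 0 \<Longrightarrow> b = c1 b *\<^sub>R x' + c2 b *\<^sub>R x + (c b / c y) *\<^sub>R y"
    using decomp by (metis add.commute)
  have sum1': "\<And>b. g b = 0 \<Longrightarrow> c1 b + c2 b + c b / c y = (1::real)"
    using sum1 by (metis add.commute)
  note A = ch y aff vals decomp sum1
  note B = chord_sym[OF ch] y aff(2,1) vals(6,5,4,3,2,1) decomp' sum1'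
  show "chord c1 x y" "chord c2 y x'" using split_chords[OF A] by auto
  show "\<And>b. b \<in> X \<Longrightarrow> c1 b < 0 \<Longrightarrow> c b < 0" using split_beyond1[OF A] by blast
  show "\<And>b. b \<in> X \<Longrightarrow> c2 b < 0 \<Longrightarrow> c b < 0" using split_beyond1[OF B] by blast
  note cd = chordD[OF ch]
  have "l \<in> arc_edges c1 \<union> arc_edges c2" if l: "l \<in> arc_edges c" for l
  proof -
    have lL: "l \<in> L" using l unfolding arc_edges_def by blast
    obtain d where d: "d \<in> X" "l d = 0" "c d < 0"
      using l y extreme_in_X unfolding arc_edges_def by force
    obtain a where a: "a \<in> X" "l a = 0" "a \<noteq> y"
      using edge_two_points[OF lL] by metis
    \<comment> \<open>A point beyond the chord other than \<open>y\<close> is wanted; if only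
      \<open>y\<close> is at hand, a small step along the edge towards \<open>a\<close> stays beyond
      the chord.\<close>
    obtain b where b: "b \<in> X" "l b = 0" "c b < 0" "b \<noteq> y"
    proof (cases "d = y")
      case False then show thesis using that d by blast
    next
      case True
      \<comment> \<open>The first bound leaves at least half of the weight on \<open>y\<close>; the
        second keeps \<open>e * c a\<close> below half of \<open>- c y\<close>.\<close>
      define e where "e = min (1/2) (- c y / (2 * (1 + \<bar>c a\<bar>)))"
      have "0 < - c y / (2 * (1 + \<bar>c a\<bar>))" using y by (intro divide_pos_pos) auto
      then have e: "0 < e" "e \<le> 1/2" "e \<le> - c y / (2 * (1 + \<bar>c a\<bar>))"
        unfolding e_def by (simp_all only: min_less_iff_conj min.cobounded1 min.cobounded2) simp
      define b where "b = (1 - e) *\<^sub>R y + e *\<^sub>R a"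
      have "b \<in> X" unfolding b_def
        by (rule convexD[OF convex_X]) (use e a y extreme_in_X in auto)
      moreover have "l b = 0" unfolding b_def
        using affine_fun_comb2[OF affine_L[OF lL], of "1-e" e] d True a by simp
      moreover have "c b < 0"
      proof -
        have "c b = (1 - e) * c y + e * c a" unfolding b_def
          by (rule affine_fun_comb2[OF cd(1)]) simp
        moreover have "e * (2 * (1 + \<bar>c a\<bar>)) \<le> - c y"
          by (rule pos_le_divide_eq[THEN iffD1, OF _ e(3)]) simp
        then have "2 * (e * \<bar>c a\<bar>) + 2 * e \<le> - c y" by (simp add: algebra_simps)
        moreover have "e * c a \<le> e * \<bar>c a\<bar>" using e by (simp add: mult_left_mono)
        moreover have "(1 - e) * c y \<le> (1/2) * c y" using e y by (intro mult_right_mono_neg) auto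
        ultimately show ?thesis using e(1) by linarith
      qed
      moreover have "b \<noteq> y"
      proof
        assume "b = y"
        then have "e *\<^sub>R (a - y) = 0" unfolding b_def by (simp add: algebra_simps)
        then show False using e a by simp
      qed
      ultimately show thesis using that by blast
    qed
    have g0: "g b = 0" using b g_X by blast
    have cy: "0 < c b / c y" using b y by (simp add: divide_neg_neg)
    show ?thesis
    proof (cases "c1 b < 0 \<or> c2 b < 0")
      case True
      then show ?thesis using b lL unfolding arc_edges_def by blast
    next
      case False
      then have nn: "0 \<le> c1 b" "0 \<le> c2 b" by auto
      \<comment> \<open>A sum of nonnegative terms vanishes, so \<open>l\<close> is zero at each
        corner with positive weight: at \<open>y\<close>, and at \<open>x\<close> or
        \<open>x'\<close> because \<open>b \<noteq> y\<close>.\<close>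
      have "l b = l (c2 b *\<^sub>R x + c1 b *\<^sub>R x' + (c b / c y) *\<^sub>R y)" using decomp[OF g0] by metis
      then have eq: "c2 b * l x + c1 b * l x' + (c b / c y) * l y = 0"
        using affine_fun_comb3[OF affine_L[OF lL] sum1[OF g0]] b by simp
      have ln: "0 \<le> l x" "0 \<le> l x'" "0 \<le> l y"
        using L_nonneg[OF lL] cd extreme_in_X y by auto
      have "0 \<le> c2 b * l x" "0 \<le> c1 b * l x'" "0 \<le> (c b / c y) * l y"
        using mult_nonneg_nonneg[OF nn(2) ln(1)] mult_nonneg_nonneg[OF nn(1) ln(2)]
          mult_nonneg_nonneg[OF less_imp_le[OF cy] ln(3)] by blast+
      then have z: "c2 b * l x = 0" "c1 b * l x' = 0" "(c b / c y) * l y = 0" using eq by linarith+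
      then have ly: "l y = 0" using cy by auto
      have "c2 b \<noteq> 0 \<or> c1 b \<noteq> 0"
        using decomp[OF g0] sum1[OF g0] b(4) by auto
      then show ?thesis
        using z ly edge_on_side[OF A lL] edge_on_side[OF B lL] by auto
    qed
  qed
  then show "arc_edges c = arc_edges c1 \<union> arc_edges c2" using split_arc1[OF A] split_arc1[OF B] by blast
qed

end

section \<open>Caps over the base\<close>

text \<open>The edge is a face of least dimension among those containing \<open>v\<close> and a
  lower point. In dimension two or more, tilting a hyperplane about \<open>v\<close> gives a face on
  which all other points are lower; by minimality this is all of \<open>S\<close>, and then a facet
  of \<open>S\<close> through \<open>v\<close> is a smaller candidate.\<close>

lemma polytope_edge_descending:
  fixes K :: "('a::euclidean_space) set"
  assumes K: "polytope K" and v: "v extreme_point_of K" and p: "p \<in> K" "a \<bullet> p < a \<bullet> v"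
  obtains S w where "S face_of K" "aff_dim S = 1" "v \<in> S" "w \<in> S" "w extreme_point_of K"
    "a \<bullet> w < a \<bullet> v"
proof -
  define good where "good = (\<lambda>S. S face_of K \<and> v \<in> S \<and> (\<exists>q\<in>S. a \<bullet> q < a \<bullet> v))"
  have vK: "v \<in> K" using v by (simp add: extreme_point_of_def)
  have "good K" unfolding good_def
    using K vK p by (simp add: face_of_refl polytope_imp_convex) blast
  then obtain S where S: "good S" "\<And>T. good T \<Longrightarrow> nat (aff_dim S) \<le> nat (aff_dim T)"
    using ex_has_least_nat[of good K "\<lambda>T. nat (aff_dim T)"] by blast
  have fS: "S face_of K" "v \<in> S" using S(1) unfolding good_def by auto
  obtain q where q: "q \<in> S" "a \<bullet> q < a \<bullet> v" using S(1) unfolding good_def by blast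
  have polyS: "polytope S" using K fS face_of_polytope_polytope by blast
  have vS: "v extreme_point_of S" using extreme_point_of_face[OF fS(1)] v fS by blast
  have dim1: "1 \<le> aff_dim S"
  proof -
    have "{v, q} \<subseteq> S" using fS q by auto
    then have "aff_dim {v, q} \<le> aff_dim S" by (rule aff_dim_subset)
    moreover have "v \<noteq> q" using q by auto
    ultimately show ?thesis by (simp add: aff_dim_2)
  qed
  have dim_le: "aff_dim S \<le> aff_dim T" if "good T" for T
  proof -
    have "0 \<le> aff_dim T" using that unfolding good_def by (metis aff_dim_negative_iff empty_iff not_le)
    then show ?thesis using S(2)[OF that] dim1 by linarith
  qed
  have ext: "\<exists>w. w extreme_point_of K \<and> w \<in> S \<and> a \<bullet> w < a \<bullet> v"
  proof (rule ccontr)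
    assume "\<not> ?thesis"
    then have nn: "a \<bullet> v \<le> a \<bullet> z" if "z extreme_point_of S" for z
      using that extreme_point_of_face[OF fS(1)] by (metis not_le)
    have "S = convex hull {z. z extreme_point_of S}"
      by (rule Krein_Milman_Minkowski) (use polyS polytope_imp_compact polytope_imp_convex in auto)
    moreover have "convex hull {z. z extreme_point_of S} \<subseteq> {z. a \<bullet> v \<le> a \<bullet> z}"
      by (rule hull_minimal) (use nn convex_halfspace_ge[of "a \<bullet> v" a] in auto)
    ultimately show False using q by force
  qed
  have "aff_dim S = 1"
  proof (rule ccontr)
    assume "aff_dim S \<noteq> 1"
    then have dim2: "2 \<le> aff_dim S" using dim1 by linarith
    have "{v} face_of S" using vS face_of_singleton by blast
    then have "{v} exposed_face_of S"
      using polyS exposed_face_of_polyhedron polytope_imp_polyhedron by blast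
    then obtain d r where d: "S \<subseteq> {x. d \<bullet> x \<le> r}" "{v} = S \<inter> {x. d \<bullet> x = r}"
      unfolding exposed_face_of_def by blast
    \<comment> \<open>Slack of a hyperplane that exposes \<open>v\<close>: zero at \<open>v\<close>,
      positive on the rest of \<open>S\<close>.\<close>
    define h where "h = (\<lambda>x. r - d \<bullet> x)"
    have h: "0 < h x" if "x \<in> S" "x \<noteq> v" for x
    proof -
      have "d \<bullet> x \<le> r" using d(1) that by blast
      moreover have "x \<notin> S \<inter> {x. d \<bullet> x = r}" using that unfolding d(2)[symmetric] by simp
      ultimately show ?thesis using that unfolding h_def by simp
    qed
    have hv: "h v = 0" using d unfolding h_def by auto
    define W where "W = {z. z extreme_point_of S} - {v}"
    have finW: "finite W"
      unfolding W_def using finite_polyhedron_extreme_points[OF polytope_imp_polyhedron[OF polyS]] by blast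
    have WS: "x \<in> S" "0 < h x" if "x \<in> W" for x
      using that h unfolding W_def extreme_point_of_def by auto
    have "W \<noteq> {}" using ext extreme_point_of_face[OF fS(1)] unfolding W_def by auto
    then obtain u where u: "u \<in> W" "\<And>x. x \<in> W \<Longrightarrow> (a \<bullet> u - a \<bullet> v) / h u \<le> (a \<bullet> x - a \<bullet> v) / h x"
      using ex_is_arg_min_if_finite[OF finW, of "\<lambda>x. (a \<bullet> x - a \<bullet> v) / h x"]
      unfolding is_arg_min_linorder by auto
    \<comment> \<open>The steepest descent relative to \<open>h\<close> among the other vertices;
      the inequality \<open>m * h x \<le> a \<bullet> x - a \<bullet> v\<close> then supports
      \<open>S\<close> at both \<open>v\<close> and \<open>u\<close>.\<close>
    define m where "m = (a \<bullet> u - a \<bullet> v) / h u"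
    have m: "m * h x \<le> a \<bullet> x - a \<bullet> v" if "x \<in> W" for x
      using u(2)[OF that] WS(2)[OF that] unfolding m_def[symmetric] by (simp add: pos_le_divide_eq)
    obtain w where w: "w extreme_point_of K" "w \<in> S" "a \<bullet> w < a \<bullet> v" using ext by blast
    have "w \<in> W" using w extreme_point_of_face[OF fS(1)] unfolding W_def by auto
    then have "m * h w < 0" using m w(3) by force
    then have m0: "m < 0" using WS(2)[OF \<open>w \<in> W\<close>] by (simp add: mult_less_0_iff)
    have hyp: "(a + m *\<^sub>R d) \<bullet> x \<ge> a \<bullet> v + m * r \<longleftrightarrow> m * h x \<le> a \<bullet> x - a \<bullet> v"
      "(a + m *\<^sub>R d) \<bullet> x = a \<bullet> v + m * r \<longleftrightarrow> m * h x = a \<bullet> x - a \<bullet> v" for x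
      unfolding h_def by (auto simp: inner_add_left algebra_simps)
    have SW: "S = convex hull {z. z extreme_point_of S}"
      by (rule Krein_Milman_Minkowski) (use polyS polytope_imp_compact polytope_imp_convex in auto)
    have "convex hull {z. z extreme_point_of S} \<subseteq> {x. (a + m *\<^sub>R d) \<bullet> x \<ge> a \<bullet> v + m * r}"
    proof (rule hull_minimal)
      show "{z. z extreme_point_of S} \<subseteq> {x. (a + m *\<^sub>R d) \<bullet> x \<ge> a \<bullet> v + m * r}"
        using m hyp hv unfolding W_def by force
    qed (rule convex_halfspace_ge)
    then have Sge: "\<And>x. x \<in> S \<Longrightarrow> (a + m *\<^sub>R d) \<bullet> x \<ge> a \<bullet> v + m * r" using SW by auto
    define T where "T = S \<inter> {x. (a + m *\<^sub>R d) \<bullet> x = a \<bullet> v + m * r}"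
    have TS: "T face_of S" unfolding T_def
      by (rule face_of_Int_supporting_hyperplane_ge) (use polyS polytope_imp_convex Sge in auto)
    have vT: "v \<in> T" unfolding T_def using fS(2) hyp(2) hv by auto
    have uT: "u \<in> T" unfolding T_def using WS[OF u(1)] hyp(2) unfolding m_def by auto
    have Tlow: "a \<bullet> x < a \<bullet> v" if "x \<in> T" "x \<noteq> v" for x
    proof -
      have "m * h x = a \<bullet> x - a \<bullet> v" "x \<in> S" using that hyp(2) unfolding T_def by auto
      moreover have "m * h x < 0" using m0 h[OF \<open>x \<in> S\<close> that(2)] by (simp add: mult_neg_pos)
      ultimately show ?thesis by linarith
    qed
    have "T face_of K" using TS fS face_of_trans by blast
    moreover have "u \<noteq> v" using u W_def by auto
    ultimately have "good T" unfolding good_def using vT uT Tlow by blast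
    then have "aff_dim S \<le> aff_dim T" by (rule dim_le)
    then have TS': "T = S" using face_of_aff_dim_lt[OF polytope_imp_convex[OF polyS] TS] by force
    have "{v} \<noteq> S" using dim2 by auto
    then obtain F where F: "F facet_of S" "{v} \<subseteq> F"
      using face_of_polyhedron_subset_facet[OF polytope_imp_polyhedron[OF polyS] \<open>{v} face_of S\<close>]
      by blast
    have "aff_dim F = aff_dim S - 1" using F unfolding facet_of_def by simp
    then have "F \<noteq> {v}" using dim2 by auto
    then obtain x where "x \<in> F" "x \<noteq> v" using F by blast
    moreover have "F \<subseteq> S" using F facet_of_imp_subset by blast
    ultimately have "good F" unfolding good_def
      using F Tlow TS' facet_of_imp_face_of fS face_of_trans by blast
    then have "aff_dim S \<le> aff_dim F" by (rule dim_le)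
    then show False using F unfolding facet_of_def by simp
  qed
  then show thesis using that fS ext by blast
qed

text \<open>A proper nonempty face is the intersection of the facets containing it; with a single
  one the edge would be two-dimensional.\<close>

lemma edge_two_facets:
  fixes K :: "('a::euclidean_space) set"
  assumes K: "polytope K" and S: "S face_of K" "aff_dim S = 1" and d: "aff_dim K = 3"
  obtains F F' where "F facet_of K" "F' facet_of K" "F \<noteq> F'" "S \<subseteq> F" "S \<subseteq> F'"
proof -
  have ne: "S \<noteq> {}" "S \<noteq> K" using S d by auto
  have SI: "S = \<Inter>{F. F facet_of K \<and> S \<subseteq> F}"
    using face_of_polyhedron[OF polytope_imp_polyhedron[OF K] S(1) ne] .
  obtain F where F: "F facet_of K" "S \<subseteq> F"
    using face_of_polyhedron_subset_facet[OF polytope_imp_polyhedron[OF K] S(1) ne] .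
  have "aff_dim F = 2" using F d unfolding facet_of_def by simp
  then have "S \<noteq> F" using S by auto
  have "\<exists>F'. F' facet_of K \<and> S \<subseteq> F' \<and> F' \<noteq> F"
  proof (rule ccontr)
    assume "\<not> ?thesis"
    then have "{F. F facet_of K \<and> S \<subseteq> F} = {F}" using F by blast
    then show False using SI \<open>S \<noteq> F\<close> by simp
  qed
  then show thesis using that F by blast
qed

section \<open>Half-space description of caps\<close>

context dome_base
begin

text \<open>Expresses that the segment \<open>vx\<close> lies in the boundary, by a supporting plane
  that leaves \<open>y\<close> strictly inside. In this form it passes to subsets of
  \<open>K\<close>.\<close>

definition sep :: "(real^3) set \<Rightarrow> real^3 \<Rightarrow> real^3 \<Rightarrow> real^3 \<Rightarrow> bool" where
  "sep K v x y \<longleftrightarrow> (\<exists>f. affine_fun f \<and> (\<forall>p\<in>K. 0 \<le> f p) \<and> f v = 0 \<and> f x = 0 \<and> 0 < f y)"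

text \<open>The form that the g-dome condition takes on the functional of a facet other than the
  base; a common edge also provides a common vertex.\<close>

definition vertex_fun :: "(real^3 \<Rightarrow> real) \<Rightarrow> bool" where
  "vertex_fun f \<longleftrightarrow> affine_fun f \<and> (\<forall>q\<in>X. 0 \<le> f q) \<and> (\<exists>z. z extreme_point_of X \<and> f z = 0) \<and>
     (\<exists>q\<in>X. 0 < f q)"

text \<open>A g-dome in half-space form, so that cutting amounts to adding functionals, which may
  fail to define facets. Solidity is supplied separately by a point with
  \<open>0 < g\<close>.\<close>

definition cap_by :: "(real^3 \<Rightarrow> real) set \<Rightarrow> (real^3) set \<Rightarrow> bool" where
  "cap_by \<Phi> K \<longleftrightarrow> finite \<Phi> \<and> (\<forall>f\<in>\<Phi>. vertex_fun f) \<and> K = {p. 0 \<le> g p \<and> (\<forall>f\<in>\<Phi>. 0 \<le> f p)} \<and>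
     bounded K \<and> K \<inter> {p. g p = 0} = X"

text \<open>What is left of \<open>K\<close> once the planes at the arc edges have been moved
  inwards to \<open>v\<close>.\<close>

definition flat :: "(real^3) set \<Rightarrow> (real^3 \<Rightarrow> real) \<Rightarrow> real^3 \<Rightarrow> (real^3) set" where
  "flat K c v = K \<inter> {p. \<forall>l\<in>arc_edges c. 0 \<le> tilt l v p}"

lemma sep_subset: "sep K v x y \<Longrightarrow> K' \<subseteq> K \<Longrightarrow> sep K' v x y"
  unfolding sep_def by blast

lemma cap_byD:
  assumes "cap_by \<Phi> K"
  shows "finite \<Phi>" "\<And>f. f \<in> \<Phi> \<Longrightarrow> vertex_fun f" "K = {p. 0 \<le> g p \<and> (\<forall>f\<in>\<Phi>. 0 \<le> f p)}"
    "bounded K" "K \<inter> {p. g p = 0} = X" "X \<subseteq> K" "\<And>p. p \<in> K \<Longrightarrow> 0 \<le> g p"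
    "\<And>f p. f \<in> \<Phi> \<Longrightarrow> p \<in> K \<Longrightarrow> 0 \<le> f p"
proof -
  have a: "finite \<Phi>" "\<forall>f\<in>\<Phi>. vertex_fun f" "K = {p. 0 \<le> g p \<and> (\<forall>f\<in>\<Phi>. 0 \<le> f p)}"
    "bounded K" "K \<inter> {p. g p = 0} = X"
    using assms[unfolded cap_by_def, THEN conjunct1]
      assms[unfolded cap_by_def, THEN conjunct2, THEN conjunct1]
      assms[unfolded cap_by_def, THEN conjunct2, THEN conjunct2, THEN conjunct1]
      assms[unfolded cap_by_def, THEN conjunct2, THEN conjunct2, THEN conjunct2, THEN conjunct1]
      assms[unfolded cap_by_def, THEN conjunct2, THEN conjunct2, THEN conjunct2, THEN conjunct2]
    by - assumption+
  show "finite \<Phi>" "K = {p. 0 \<le> g p \<and> (\<forall>f\<in>\<Phi>. 0 \<le> f p)}" "bounded K" "K \<inter> {p. g p = 0} = X"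
    by (fact a)+
  show "vertex_fun f" if "f \<in> \<Phi>" for f using a(2) that by blast
  show "X \<subseteq> K" using a(5) by blast
  have "p \<in> {p. 0 \<le> g p \<and> (\<forall>f\<in>\<Phi>. 0 \<le> f p)}" if "p \<in> K" for p using a(3) that by simp
  then show "0 \<le> g p" "f \<in> \<Phi> \<Longrightarrow> 0 \<le> f p" if "p \<in> K" for p f using that by blast+
qed

lemma cap_by_polytope:
  assumes "cap_by \<Phi> K" shows "polytope K"
proof -
  note cD = cap_byD[OF assms]
  have "K = {p. 0 \<le> g p} \<inter> \<Inter>((\<lambda>f. {p. 0 \<le> f p}) ` \<Phi>)" by (subst cD(3)) auto
  also have "polyhedron \<dots>"
    using cD(1,2) affine_fun_level(1) affine_g unfolding vertex_fun_def
    by (intro polyhedron_Int polyhedron_Inter) auto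
  finally show ?thesis using cD(4) polytope_eq_bounded_polyhedron by blast
qed

lemma vertex_fun_tilt: "l \<in> L \<Longrightarrow> vertex_fun (tilt l v)"
proof -
  assume l: "l \<in> L"
  have e: "tilt l v q = l q" if "q \<in> X" for q using that by (simp add: tilt_base g_X)
  obtain z where "z extreme_point_of X" "l z = 0" using edge_extreme[OF l] by blast
  moreover obtain q where "q \<in> X" "0 < l q" using pos_L[OF l] by blast
  ultimately show ?thesis
    unfolding vertex_fun_def using e L_nonneg[OF l] affine_tilt[OF affine_L[OF l]] extreme_in_X
    by auto
qed

text \<open>Vertex functionals are nonnegative on \<open>X\<close>, so cutting by them leaves the
  base intact.\<close>

lemma cap_by_cut:
  assumes "cap_by \<Phi> K" "finite \<Psi>" "\<And>f. f \<in> \<Psi> \<Longrightarrow> vertex_fun f"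
  shows "cap_by (\<Phi> \<union> \<Psi>) (K \<inter> {p. \<forall>f\<in>\<Psi>. 0 \<le> f p})"
proof -
  note cD = cap_byD[OF assms(1)]
  have "K \<inter> {p. \<forall>f\<in>\<Psi>. 0 \<le> f p} \<inter> {p. g p = 0} = X"
    using cD(5) assms(3) unfolding vertex_fun_def by blast
  moreover have "bounded (K \<inter> {p. \<forall>f\<in>\<Psi>. 0 \<le> f p})" using cD(4) by (meson bounded_subset inf_le1)
  moreover have "K \<inter> {p. \<forall>f\<in>\<Psi>. 0 \<le> f p} = {p. 0 \<le> g p \<and> (\<forall>f\<in>\<Phi> \<union> \<Psi>. 0 \<le> f p)}"
    by (subst cD(3)) auto
  moreover have "finite (\<Phi> \<union> \<Psi>)" "\<forall>f\<in>\<Phi> \<union> \<Psi>. vertex_fun f" using cD(1,2) assms(2,3) by auto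
  ultimately show ?thesis unfolding cap_by_def by (intro conjI)
qed

lemma cap_by_flat:
  assumes "cap_by \<Phi> K"
  shows "cap_by (\<Phi> \<union> (\<lambda>l. tilt l v) ` arc_edges c) (flat K c v)"
proof -
  have "flat K c v = K \<inter> {p. \<forall>f\<in>(\<lambda>l. tilt l v) ` arc_edges c. 0 \<le> f p}" unfolding flat_def by auto
  moreover have "finite ((\<lambda>l. tilt l v) ` arc_edges c)" using finite_L unfolding arc_edges_def by simp
  moreover have "\<And>f. f \<in> (\<lambda>l. tilt l v) ` arc_edges c \<Longrightarrow> vertex_fun f"
    using vertex_fun_tilt unfolding arc_edges_def by blast
  ultimately show ?thesis by (simp only: cap_by_cut[OF assms])
qed

lemma cap_by_aff_dim:
  assumes K: "cap_by \<Phi> K" and v: "v \<in> K" "0 < g v"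
  shows "aff_dim K = 3" "interior K \<noteq> {}"
proof -
  have "v \<notin> affine hull X"
    using affine_fun_zero_affine_hull[OF affine_g, of X v] g_X v by auto
  then have "aff_dim (insert v X) = 3" using aff_dim_X by (simp add: aff_dim_insert)
  moreover have "insert v X \<subseteq> K" using cap_byD[OF K] v by blast
  ultimately have "3 \<le> aff_dim K" by (metis aff_dim_subset)
  moreover have "aff_dim K \<le> 3" using aff_dim_le_DIM[of K] by simp
  ultimately show d: "aff_dim K = 3" by simp
  have "convex K" using cap_by_polytope[OF K] polytope_imp_convex by blast
  then have "rel_interior K \<noteq> {}" using v rel_interior_eq_empty by blast
  then show "interior K \<noteq> {}" using d by (simp add: interior_rel_interior_gen)
qed

text \<open>A relative interior point of \<open>F\<close> is a boundary point of \<open>K\<close>,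
  so a defining functional vanishes there. Its zero face contains \<open>F\<close> and is proper,
  hence equals \<open>F\<close> by dimension.\<close>

lemma facet_functional:
  assumes K: "cap_by \<Phi> K" and int: "interior K \<noteq> {}" and F: "F facet_of K" "F \<noteq> X"
  obtains f where "f \<in> \<Phi>" "F = K \<inter> {p. f p = 0}"
proof -
  note cD = cap_byD[OF K]
  have convK: "convex K" using cap_by_polytope[OF K] polytope_imp_convex by blast
  have Ff: "F face_of K" "F \<noteq> {}" "F \<noteq> K" using F unfolding facet_of_def by auto
  then have convF: "convex F" using face_of_imp_convex by blast
  then obtain r where r: "r \<in> rel_interior F" using Ff rel_interior_eq_empty by blast
  have rF: "r \<in> F" using r rel_interior_subset by blast
  have rK: "r \<in> K" using rF Ff face_of_imp_subset by blast
  have rn: "r \<notin> interior K" using face_of_disjoint_interior[OF Ff(1,3)] rF by blast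
  have "\<exists>f\<in>insert g \<Phi>. f r = 0"
  proof (rule ccontr)
    assume "\<not> ?thesis"
    then have pos: "\<And>f. f \<in> insert g \<Phi> \<Longrightarrow> 0 < f r"
      using cD(7,8) rK by (metis insert_iff less_eq_real_def)
    \<comment> \<open>If all functionals were positive at \<open>r\<close>, finitely many open
      half-spaces would give a neighbourhood inside \<open>K\<close>.\<close>
    define U where "U = \<Inter>((\<lambda>f. {p. 0 < f p}) ` insert g \<Phi>)"
    have "open U" unfolding U_def
    proof (rule open_Inter)
      show "finite ((\<lambda>f. {p. 0 < f p}) ` insert g \<Phi>)" using cD(1) by simp
      show "\<forall>S\<in>(\<lambda>f. {p. 0 < f p}) ` insert g \<Phi>. open S"
      proof clarify
        fix f assume "f \<in> insert g \<Phi>"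
        then have "affine_fun f" using affine_g cD(2) unfolding vertex_fun_def by blast
        then show "open {p. 0 < f p}"
          by (intro open_Collect_less affine_fun_continuous continuous_on_const)
      qed
    qed
    moreover have "U \<subseteq> K" unfolding U_def using cD(3) by force
    moreover have "r \<in> U" unfolding U_def using pos by auto
    ultimately show False using rn interiorI by blast
  qed
  then obtain f where f: "f \<in> insert g \<Phi>" "f r = 0" by blast
  have aff: "affine_fun f" using f affine_g cD(2) unfolding vertex_fun_def by blast
  define T where "T = K \<inter> {p. f p = 0}"
  have T: "T face_of K" unfolding T_def
    by (rule affine_fun_face[OF aff convK]) (use cD(7,8) f in auto)
  have "F \<subseteq> T"
    by (rule subset_of_face_of[OF T]) (use Ff face_of_imp_subset r rF rK f T_def in blast)+
  have "\<exists>q. f q \<noteq> 0" using f g_pos cD(2) unfolding vertex_fun_def by (metis insert_iff less_irrefl)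
  then obtain q where q: "f q \<noteq> 0" by blast
  obtain i where i: "i \<in> interior K" using int by blast
  have "0 < f i" by (rule affine_fun_interior_pos[OF aff _ q i]) (use cD(7,8) f in auto)
  then have "i \<in> K" "i \<notin> T" using i interior_subset unfolding T_def by auto
  then have "T \<noteq> K" by blast
  then have "aff_dim T < aff_dim K" using face_of_aff_dim_lt[OF convK T] by blast
  then have "aff_dim T \<le> aff_dim F" using F unfolding facet_of_def by simp
  moreover have "F face_of T" using Ff \<open>F \<subseteq> T\<close> T by (meson face_of_face)
  ultimately have "F = T"
    using face_of_aff_dim_lt[OF face_of_imp_convex[OF T]] by force
  moreover have "f \<noteq> g" using calculation F(2) cD(5) unfolding T_def by blast
  ultimately show thesis using that f unfolding T_def by blast
qed

section \<open>Sections by planes through a chord\<close>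

text \<open>The section lies in the triangle \<open>x x' v\<close>: the two \<open>sep\<close>
  functionals make the coordinates of \<open>x'\<close> and \<open>x\<close> nonnegative, and
  \<open>g\<close> does so for \<open>v\<close>.\<close>

lemma slice_triangle:
  assumes ch: "chord c x x'" and v: "0 < g v" and K: "\<And>q. q \<in> K \<Longrightarrow> 0 \<le> g q"
    and s: "sep K v x x'" "sep K v x' x" and p: "p \<in> K" "tilt c v p = 0"
  obtains r s t where "0 \<le> r" "0 \<le> s" "0 \<le> t" "r + s + t = (1::real)"
    "p = r *\<^sub>R x + s *\<^sub>R x' + t *\<^sub>R v"
proof -
  note cd = chordD[OF ch]
  obtain z where z: "z \<in> X" "c z \<noteq> 0" using cd(9) by blast
  have v0: "g v \<noteq> 0" using v by simp
  obtain A B C D where co: "\<And>p. A p + B p + C p + D p = (1::real)"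
    "\<And>p. p = A p *\<^sub>R x + B p *\<^sub>R x' + C p *\<^sub>R z + D p *\<^sub>R v"
    using barycentric_coordinates[OF affine_g g_X[OF cd(7)] g_X[OF cd(8)] g_X[OF z(1)] v0
        cd(1) cd(5) cd(6) z(2) cd(4)]
    by metis
  have ev: "f p = A p * f x + B p * f x' + C p * f z + D p * f v" if "affine_fun f" for f
    using affine_fun_comb4[OF that co(1)] co(2) by metis
  have C0: "C p = 0" using ev[OF affine_tilt[OF cd(1)], of v] p cd z v0
    by (simp add: tilt_base g_X tilt_self)
  have "g p = D p * g v" using ev[OF affine_g] g_X cd z by simp
  then have D: "0 \<le> D p" using K[OF p(1)] v by (simp add: zero_le_mult_iff)
  obtain f where f: "affine_fun f" "\<forall>p\<in>K. 0 \<le> f p" "f v = 0" "f x = 0" "0 < f x'"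
    using s(1) unfolding sep_def by blast
  have "f p = B p * f x'" using ev[OF f(1)] f C0 by simp
  then have B: "0 \<le> B p" using f p by (metis less_le_not_le mult_neg_pos not_le)
  obtain f where f: "affine_fun f" "\<forall>p\<in>K. 0 \<le> f p" "f v = 0" "f x' = 0" "0 < f x"
    using s(2) unfolding sep_def by blast
  have "f p = A p * f x" using ev[OF f(1)] f C0 by simp
  then have A: "0 \<le> A p" using f p by (metis less_le_not_le mult_neg_pos not_le)
  show thesis by (rule that[OF A B D]) (use co(1)[of p] co(2)[of p] C0 in auto)
qed

text \<open>With \<open>X\<close> on the side \<open>c \<ge> 0\<close>, an arc edge lies on the
  chord, so the two planes agree; a point of \<open>X\<close> off the edge gives the sign of the
  factor.\<close>

lemma arc_supporting_chord:
  assumes c: "affine_fun c" "\<exists>z\<in>X. c z \<noteq> 0" and nn: "\<forall>q\<in>X. 0 \<le> c q" and l: "l \<in> arc_edges c"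
  obtains k where "0 < k" "\<And>v p. g v \<noteq> 0 \<Longrightarrow> tilt l v p = k * tilt c v p"
proof -
  have lL: "l \<in> L" using l unfolding arc_edges_def by blast
  have zz: "\<forall>b\<in>X. l b = 0 \<longrightarrow> c b = 0" using l nn unfolding arc_edges_def by force
  obtain a b where ab: "a \<in> X" "b \<in> X" "a \<noteq> b" "l a = 0" "l b = 0"
    using edge_two_points[OF lL] by blast
  obtain k where k: "k \<noteq> 0" "\<forall>v p. g v \<noteq> 0 \<longrightarrow> tilt l v p = k * tilt c v p"
    using chord_edge_unique[OF c lL ab(1-3) _ _ ab(4,5)] zz ab by blast
  obtain q where q: "q \<in> X" "0 < l q" using pos_L[OF lL] by blast
  obtain v where v: "g v \<noteq> 0" using g_pos by force
  have "l q = k * c q" using k v q by (metis g_X tilt_base)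
  then have "0 < k" using q nn by (metis less_le_not_le mult_nonpos_nonneg not_le)
  then show thesis using that k by blast
qed

text \<open>Otherwise the segment to \<open>p\<close> from a point \<open>b\<close> of the edge
  beyond the chord would cross the triangle \<open>x x' v\<close>, where \<open>tilt l v\<close> is
  nonnegative, although it is zero at \<open>b\<close> and negative at \<open>p\<close>.\<close>

lemma arc_local:
  assumes ch: "chord c x x'" and v: "0 < g v" and K: "convex K" "X \<subseteq> K" "\<And>q. q \<in> K \<Longrightarrow> 0 \<le> g q"
    and s: "sep K v x x'" "sep K v x' x" and p: "p \<in> K" "0 \<le> tilt c v p" and l: "l \<in> arc_edges c"
  shows "0 \<le> tilt l v p"
proof -
  note cd = chordD[OF ch]
  have v0: "g v \<noteq> 0" using v by simp
  have lL: "l \<in> L" using l unfolding arc_edges_def by blast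
  show ?thesis
  proof (cases "\<exists>b\<in>X. l b = 0 \<and> c b < 0")
    case False
    then have nn: "\<forall>q\<in>X. 0 \<le> c q" using l unfolding arc_edges_def by blast
    obtain k where "0 < k" "tilt l v p = k * tilt c v p"
      using arc_supporting_chord[OF cd(1,9) nn l] v0 by metis
    then show ?thesis using p by simp
  next
    case True
    then obtain b where b: "b \<in> X" "l b = 0" "c b < 0" by blast
    show ?thesis
    proof (rule ccontr)
      assume "\<not> 0 \<le> tilt l v p"
      then have neg: "tilt l v p < 0" by simp
      define t where "t = - c b / (tilt c v p - c b)"
      have t: "0 < t" "t \<le> 1" unfolding t_def using b p by (auto simp: field_simps)
      define r where "r = (1 - t) *\<^sub>R b + t *\<^sub>R p"
      have rK: "r \<in> K" unfolding r_def by (rule convexD[OF K(1)]) (use b K p t in auto)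
      have ev: "f r = (1 - t) * f b + t * f p" if "affine_fun f" for f
        unfolding r_def by (rule affine_fun_comb2[OF that]) simp
      have "tilt c v r = c b + t * (tilt c v p - c b)"
        using ev[OF affine_tilt[OF cd(1)], of v] b by (simp add: tilt_base g_X algebra_simps)
      also have "\<dots> = 0" unfolding t_def using b p by (simp add: field_simps)
      finally obtain i j k where i: "0 \<le> i" "0 \<le> j" "0 \<le> k" "i + j + k = (1::real)"
        "r = i *\<^sub>R x + j *\<^sub>R x' + k *\<^sub>R v"
        using slice_triangle[OF ch v K(3) s rK] by blast
      have "tilt l v r = i * l x + j * l x'"
        using affine_fun_comb3[OF affine_tilt[OF affine_L[OF lL]] i(4)] i(5) cd v0
        by (simp add: tilt_base g_X tilt_self)
      then have "0 \<le> tilt l v r" using i L_nonneg[OF lL] cd by simp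
      moreover have "tilt l v r = t * tilt l v p"
        using ev[OF affine_tilt[OF affine_L[OF lL]], of v] b by (simp add: tilt_base g_X)
      ultimately show False using neg t by (simp add: zero_le_mult_iff)
    qed
  qed
qed

text \<open>Nothing of \<open>X\<close> lies beyond the chord either, so arc edges lie on the chord
  and their planes through \<open>v\<close> are the chord plane.\<close>

lemma flat_trivial:
  assumes ch: "chord c x x'" and v: "0 < g v" and K: "X \<subseteq> K" "\<forall>p\<in>K. 0 \<le> tilt c v p"
  shows "flat K c v = K"
proof -
  note cd = chordD[OF ch]
  have "\<forall>q\<in>X. 0 \<le> tilt c v q" using K by blast
  then have nn: "\<forall>q\<in>X. 0 \<le> c q" by (simp add: tilt_base g_X)
  have "0 \<le> tilt l v p" if "p \<in> K" "l \<in> arc_edges c" for p l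
  proof -
    obtain k where "0 < k" "tilt l v p = k * tilt c v p"
      using arc_supporting_chord[OF cd(1,9) nn \<open>l \<in> arc_edges c\<close>] v by (metis less_irrefl)
    then show ?thesis using K \<open>p \<in> K\<close> by simp
  qed
  then show ?thesis unfolding flat_def by blast
qed

text \<open>Either the two supporting planes separate the chord ends, or one of them contains
  \<open>v\<close>, \<open>x\<close> and \<open>y\<close>; it is then the chord plane, oriented by
  means of \<open>t\<close>.\<close>

lemma sep_or_trivial:
  assumes ch: "chord c x y" and v: "0 < g v" and K: "X \<subseteq> K"
    and f: "affine_fun f" "\<forall>p\<in>K. 0 \<le> f p" "f v = 0" "f x = 0" "\<exists>q\<in>X. 0 < f q"
    and h: "affine_fun h" "\<forall>p\<in>K. 0 \<le> h p" "h v = 0" "h y = 0" "\<exists>q\<in>X. 0 < h q"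
    and t: "t \<in> X" "0 < c t"
  shows "(sep K v x y \<and> sep K v y x) \<or> (\<forall>p\<in>K. 0 \<le> tilt c v p)"
proof -
  note cd = chordD[OF ch]
  have v0: "g v \<noteq> 0" using v by simp
  have key: "\<forall>p\<in>K. 0 \<le> tilt c v p"
    if f: "affine_fun f" "\<forall>p\<in>K. 0 \<le> f p" "f v = 0" "f x = 0" "f y = 0" "\<exists>q\<in>X. 0 < f q" for f
  proof -
    have e: "f p = f t / c t * tilt c v p" for p
      by (rule tilt_unique[OF cd(7,8,4,1,5,6) t(1) _ v0 f(1) f(4,5,3)]) (use t in simp)
    have "f t / c t \<noteq> 0" using e f(6) by force
    moreover have "0 \<le> f t" using f K t by blast
    ultimately have "0 < f t / c t" using t by simp
    then show ?thesis using e f(2) by (metis mult_less_0_iff not_le)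
  qed
  show ?thesis
  proof (cases "f y = 0 \<or> h x = 0")
    case True
    then show ?thesis using key[of f] key[of h] f h by blast
  next
    case False
    moreover have "0 \<le> f y" "0 \<le> h x" using f h K cd by blast+
    ultimately have "0 < f y" "0 < h x" by auto
    then show ?thesis using f h unfolding sep_def by blast
  qed
qed

end

section \<open>Cutting off pyramids\<close>

text \<open>Constraints active at \<open>p\<close> vanish along the line \<open>pw\<close>; the
  finitely many others have slack for a short step either way.\<close>

lemma affine_funs_perturb:
  assumes "finite \<Psi>" "\<And>f. f \<in> \<Psi> \<Longrightarrow> affine_fun f" "\<And>f. f \<in> \<Psi> \<Longrightarrow> 0 \<le> f p"
    "\<And>f. f \<in> \<Psi> \<Longrightarrow> f p = 0 \<Longrightarrow> f w = 0"
  shows "\<exists>e>0. \<forall>f\<in>\<Psi>. \<forall>s. \<bar>s\<bar> \<le> e \<longrightarrow> 0 \<le> f (p + s *\<^sub>R (p - w))"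
  using assms
proof (induction rule: finite_induct)
  case empty
  then show ?case by (auto intro: exI[of _ 1])
next
  case (insert f \<Psi>)
  then obtain e where e: "e > 0" "\<forall>f\<in>\<Psi>. \<forall>s. \<bar>s\<bar> \<le> e \<longrightarrow> 0 \<le> f (p + s *\<^sub>R (p - w))" by auto
  have ev: "f (p + s *\<^sub>R (p - w)) = f p + s * (f p - f w)" for s
    by (rule affine_fun_diff_point) (use insert in auto)
  show ?case
  proof (cases "f p = 0")
    case True
    then have "f w = 0" using insert by auto
    then show ?thesis using e ev True by auto
  next
    case False
    then have fp: "0 < f p" using insert.prems(2)[of f] by simp
    define m where "m = f p / (1 + \<bar>f p - f w\<bar>)"
    have m: "0 < m" unfolding m_def using fp by (intro divide_pos_pos) auto
    have mm: "m * (1 + \<bar>f p - f w\<bar>) = f p" unfolding m_def by simp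
    have "0 \<le> f (p + s *\<^sub>R (p - w))" if "\<bar>s\<bar> \<le> m" for s
    proof -
      have "\<bar>s * (f p - f w)\<bar> \<le> m * \<bar>f p - f w\<bar>" unfolding abs_mult
        by (rule mult_right_mono) (use that in auto)
      moreover have "m * \<bar>f p - f w\<bar> \<le> f p" using mm m by (simp add: distrib_left)
      ultimately show ?thesis unfolding ev by linarith
    qed
    then show ?thesis using e m by (intro exI[of _ "min e m"]) auto
  qed
qed

text \<open>Otherwise \<open>p\<close> could be moved both ways along the line to \<open>w\<close>.
  The criterion serves to show that a piece cut off has a single vertex strictly beyond the
  plane.\<close>

lemma extreme_point_active:
  assumes K: "K = {p. \<forall>f\<in>\<Psi>. 0 \<le> f p}" and \<Psi>: "finite \<Psi>" "\<And>f. f \<in> \<Psi> \<Longrightarrow> affine_fun f"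
    and p: "p extreme_point_of K" and act: "\<And>f. f \<in> \<Psi> \<Longrightarrow> f p = 0 \<Longrightarrow> f w = 0"
  shows "p = w"
proof (rule ccontr)
  assume pw: "p \<noteq> w"
  have pK: "p \<in> K" using p by (simp add: extreme_point_of_def)
  have nn: "0 \<le> f p" if "f \<in> \<Psi>" for f using pK that unfolding K by blast
  have "\<exists>e>0. \<forall>f\<in>\<Psi>. \<forall>s. \<bar>s\<bar> \<le> e \<longrightarrow> 0 \<le> f (p + s *\<^sub>R (p - w))"
    by (rule affine_funs_perturb[OF \<Psi>(1)]) (use \<Psi> nn act in auto)
  then obtain e where e: "e > 0" "\<forall>f\<in>\<Psi>. \<forall>s. \<bar>s\<bar> \<le> e \<longrightarrow> 0 \<le> f (p + s *\<^sub>R (p - w))"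
    by blast
  define a b where "a = p + e *\<^sub>R (p - w)" and "b = p + (- e) *\<^sub>R (p - w)"
  have "a \<in> K" "b \<in> K" unfolding K a_def b_def
    using e(1) e(2)[rule_format, of _ e] e(2)[rule_format, of _ "- e"] by auto
  moreover have "p = (1 - 1/2) *\<^sub>R a + (1/2) *\<^sub>R b"
  proof -
    have "a + b = 2 *\<^sub>R p" unfolding a_def b_def by (simp add: scaleR_2)
    then have "(1/2) *\<^sub>R (a + b) = p" by simp
    then show ?thesis by (simp add: scaleR_add_right)
  qed
  moreover have "a \<noteq> b"
  proof
    assume "a = b"
    then have "e *\<^sub>R (p - w) + e *\<^sub>R (p - w) = 0"
      unfolding a_def b_def by (simp add: algebra_simps)
    then have "(e + e) *\<^sub>R (p - w) = 0" by (simp only: scaleR_add_left)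
    then show False using e pw by simp
  qed
  then have "p \<in> open_segment a b" unfolding in_segment
    using calculation(3) by (intro conjI exI[of _ "1/2"]) auto
  ultimately show False using p unfolding extreme_point_of_def by blast
qed

section \<open>A single cut\<close>

context dome_base
begin

text \<open>One pyramid with apex \<open>w\<close> is cut off by a plane through \<open>v\<close>
  and an edge of \<open>X\<close>; as \<open>v\<close> is off the base plane, the section is
  two-dimensional.\<close>

definition cut_step :: "(real^3) set \<Rightarrow> (real^3) set \<Rightarrow> bool" where
  "cut_step K K' \<longleftrightarrow> (\<exists>l\<in>L. \<exists>v\<in>K. \<exists>w\<in>K. 0 < g v \<and> tilt l v w < 0 \<and>
     K \<inter> {p. tilt l v p \<le> 0} = convex hull (insert w (K \<inter> {p. tilt l v p = 0})) \<and>
     K' = K \<inter> {p. 0 \<le> tilt l v p})"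

lemma tilt_shift: "tilt c w p = tilt c v p + (c v / g v - c w / g w) * g p"
  by (simp add: tilt_def algebra_simps)

text \<open>Projecting \<open>p\<close> from \<open>w\<close> to the base plane lands in the region
  beyond the chord bounded by the arc, hence in \<open>X\<close>. This needs \<open>p\<close> lower
  than \<open>w\<close>; otherwise the region would contain a ray.\<close>

lemma cone_over_arc:
  assumes ch: "chord c x x'" and w: "0 < g w" and p: "0 < g p" "tilt c w p < 0"
    "\<And>l. l \<in> arc_edges c \<Longrightarrow> 0 \<le> tilt l w p"
  obtains d z where "0 < d" "d < 1" "z \<in> X" "p = d *\<^sub>R w + (1 - d) *\<^sub>R z"
proof -
  note cd = chordD[OF ch]
  have w0: "g w \<noteq> 0" using w by simp
  have affl: "affine_fun l" if "l \<in> arc_edges c" for l using that affine_L unfolding arc_edges_def by blast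
  have less: "g p < g w"
  proof (rule ccontr)
    assume "\<not> g p < g w"
    then have ge: "g w \<le> g p" by simp
    \<comment> \<open>Shrinking towards \<open>x\<close> brings \<open>p\<close> to the height of
      \<open>w\<close>; then \<open>m - w\<close> is parallel to the base plane and points along the
      ray.\<close>
    define s where "s = g w / g p"
    have s: "0 < s" "s \<le> 1" unfolding s_def using ge w by auto
    define m where "m = (1 - s) *\<^sub>R x + s *\<^sub>R p"
    have ev: "f m = (1 - s) * f x + s * f p" if "affine_fun f" for f
      unfolding m_def by (rule affine_fun_comb2[OF that]) simp
    have gm: "g m = g w" using ev[OF affine_g] g_X[OF cd(7)] p by (simp add: s_def)
    have cm: "tilt c w m < 0" using ev[OF affine_tilt[OF cd(1)], of w] s p cd
      by (simp add: tilt_base g_X mult_pos_neg)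
    have lm: "0 \<le> tilt l w m" if l: "l \<in> arc_edges c" for l
    proof -
      have "0 \<le> l x" using l L_nonneg cd unfolding arc_edges_def by blast
      then show ?thesis using ev[OF affine_tilt[OF affl[OF l]], of w] s p(3)[OF l] cd
        by (simp add: tilt_base g_X)
    qed
    have ray: "x + t *\<^sub>R (m - w) \<in> X" if t: "0 < t" for t
    proof (rule arc_region[OF ch])
      have rv: "f (x + t *\<^sub>R (m - w)) = f x + t * (f m - f w)" if "affine_fun f" for f
        by (rule affine_fun_diff_point[OF that])
      show g0: "g (x + t *\<^sub>R (m - w)) = 0" using rv[OF affine_g] gm g_X cd by simp
      have "c (x + t *\<^sub>R (m - w)) = tilt c w (x + t *\<^sub>R (m - w))" using g0 by (simp add: tilt_base)
      also have "\<dots> = t * tilt c w m"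
        using rv[OF affine_tilt[OF cd(1)], of w] cd by (simp add: tilt_base g_X tilt_self[OF w0])
      also have "\<dots> < 0" using t cm by (simp add: mult_pos_neg)
      finally show "c (x + t *\<^sub>R (m - w)) < 0" .
      fix l assume l: "l \<in> arc_edges c"
      have "l (x + t *\<^sub>R (m - w)) = tilt l w (x + t *\<^sub>R (m - w))" using g0 by (simp add: tilt_base)
      also have "\<dots> = l x + t * tilt l w m"
        using rv[OF affine_tilt[OF affl[OF l]], of w] cd by (simp add: tilt_base g_X tilt_self[OF w0])
      finally show "0 \<le> l (x + t *\<^sub>R (m - w))"
        using lm[OF l] t l L_nonneg cd unfolding arc_edges_def by auto
    qed
    obtain B where B: "0 < B" "\<And>q. q \<in> X \<Longrightarrow> norm q \<le> B"
      using bounded_X bounded_pos by blast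
    have mw: "0 < norm (m - w)" using cm tilt_self[OF w0] by auto
    \<comment> \<open>A step longer than \<open>2 * B\<close>, which bounds distances within
      \<open>X\<close>.\<close>
    define t where "t = (2 * B + 1) / norm (m - w)"
    have t: "0 < t" unfolding t_def using B mw by (intro divide_pos_pos) auto
    have "norm (t *\<^sub>R (m - w)) = 2 * B + 1" using t mw B unfolding t_def by simp
    moreover have "norm (t *\<^sub>R (m - w)) \<le> norm (x + t *\<^sub>R (m - w)) + norm x"
      by (metis add_diff_cancel_left' norm_triangle_ineq4)
    ultimately show False using B(2)[OF ray[OF t]] B(2)[OF cd(7)] by linarith
  qed
  define d where "d = g p / g w"
  have d: "0 < d" "d < 1" unfolding d_def using p less w by auto
  define z where "z = (1 / (1 - d)) *\<^sub>R p + (- d / (1 - d)) *\<^sub>R w"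
  have sum: "1 / (1 - d) + (- d / (1 - d)) = 1"
    using d by (simp add: diff_divide_distrib[symmetric])
  have ev: "f z = (1 / (1 - d)) * f p + (- d / (1 - d)) * f w" if "affine_fun f" for f
    unfolding z_def by (rule affine_fun_comb2[OF that sum])
  have "g z = (g p - d * g w) / (1 - d)" using ev[OF affine_g] by (simp add: diff_divide_distrib)
  then have gz: "g z = 0" unfolding d_def using w0 by simp
  have tz: "f z = tilt f w p / (1 - d)" if "affine_fun f" for f
    using ev[OF affine_tilt[OF that], of w] gz by (simp add: tilt_base tilt_self[OF w0])
  have "z \<in> X"
  proof (rule arc_region[OF ch gz])
    show "c z < 0" unfolding tz[OF cd(1)] using p d by (simp add: divide_neg_pos)
    show "0 \<le> l z" if l: "l \<in> arc_edges c" for l unfolding tz[OF affl[OF l]] using p(3)[OF l] d by simp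
  qed
  moreover have "p = d *\<^sub>R w + (1 - d) *\<^sub>R z" unfolding z_def using d by (simp add: scaleR_add_right scaleR_diff_right)
  ultimately show thesis using that d by blast
qed

text \<open>Below, \<open>vw\<close> is an edge of \<open>K\<close> and the two facets containing it meet \<open>X\<close> in \<open>x\<close> and
  \<open>x'\<close>; between the planes \<open>tilt c v = 0\<close> and \<open>tilt c w = 0\<close>, \<open>K\<close> is the tetrahedron
  \<open>x x' v w\<close>.\<close>

lemma tetrahedron_active:
  assumes ch: "chord c x x'" and v: "v \<in> K" "0 < g v" and w: "w \<in> K" "0 < g w" "tilt c v w < 0"
    and X: "X \<subseteq> K"
    and f1: "affine_fun f1" "\<forall>p\<in>K. 0 \<le> f1 p" "f1 v = 0" "f1 w = 0" "f1 x = 0" "0 < f1 x'"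
    and f2: "affine_fun f2" "\<forall>p\<in>K. 0 \<le> f2 p" "f2 v = 0" "f2 w = 0" "f2 x' = 0" "0 < f2 x"
    and p: "p \<in> K" "tilt c v p < 0" "0 \<le> tilt c w p"
    and f: "affine_fun f" "\<forall>p\<in>K. 0 \<le> f p" "f p = 0"
  shows "f w = 0"
proof -
  note cd = chordD[OF ch]
  have v0: "g v \<noteq> 0" "g w \<noteq> 0" using v w by auto
  have tx: "tilt c v x = 0" "tilt c v x' = 0" "tilt c v v = 0" "tilt c v w \<noteq> 0"
    using cd g_X v0 w by (simp_all add: tilt_base tilt_self)
  obtain A B C D where co: "\<And>p. A p + B p + C p + D p = (1::real)"
    "\<And>p. p = A p *\<^sub>R x + B p *\<^sub>R x' + C p *\<^sub>R v + D p *\<^sub>R w"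
    using barycentric_coordinates[OF affine_tilt[OF cd(1)] tx affine_g g_X[OF cd(7)] g_X[OF cd(8)]
        v0(1) cd(4)]
    by metis
  have ev: "f p = A p * f x + B p * f x' + C p * f v + D p * f w" if "affine_fun f" for f
    using affine_fun_comb4[OF that co(1)] co(2) by metis
  have "tilt c v p = D p * tilt c v w" using ev[OF affine_tilt[OF cd(1)], of v] tx by simp
  then have D: "0 < D p" using p w by (metis less_irrefl mult_nonpos_nonpos not_le less_imp_le)
  have "tilt c w p = C p * tilt c w v"
    using ev[OF affine_tilt[OF cd(1)], of w] cd g_X v0 by (simp add: tilt_base tilt_self)
  moreover have "0 < tilt c w v"
    using tilt_swap[OF v0, of c] tilt_shift[of c v w w] w v tilt_shift[of c w v v]
    by (simp add: tilt_self v0 mult_less_0_iff zero_less_mult_iff)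
  ultimately have C: "0 \<le> C p" using p by (simp add: zero_le_mult_iff)
  have "f1 p = B p * f1 x'" using ev[OF f1(1)] f1 by simp
  then have B: "0 \<le> B p" using f1 p by (metis mult_neg_pos not_le)
  have "f2 p = A p * f2 x" using ev[OF f2(1)] f2 by simp
  then have A: "0 \<le> A p" using f2 p by (metis mult_neg_pos not_le)
  \<comment> \<open>The weights of \<open>p\<close> are nonnegative and that of \<open>w\<close> is
    positive, so a functional nonnegative at the corners and zero at \<open>p\<close> vanishes at
    \<open>w\<close>.\<close>
  have fn: "0 \<le> f x" "0 \<le> f x'" "0 \<le> f v" "0 \<le> f w" using f(2) X cd v w by blast+
  have "0 \<le> A p * f x" "0 \<le> B p * f x'" "0 \<le> C p * f v" "0 \<le> D p * f w"
    using A B C D fn by simp_all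
  then have "D p * f w = 0" using ev[OF f(1)] f(3) by linarith
  then show ?thesis using D by simp
qed

text \<open>Once the arc planes pass through \<open>w\<close>, each constraint active at an extreme
  point strictly beyond the plane of \<open>l\<close> and \<open>v\<close> also vanishes at
  \<open>w\<close>, so that point is \<open>w\<close>. If nothing lies strictly beyond, no step is
  made.\<close>

lemma pyramid_cut:
  assumes K: "cap_by \<Phi> K" and ch: "chord c x x'"
    and v: "v \<in> K" "0 < g v" "sep K v x x'" "sep K v x' x"
    and w: "w \<in> K" "0 < g w" "tilt c v w < 0"
    and f1: "affine_fun f1" "\<forall>p\<in>K. 0 \<le> f1 p" "f1 v = 0" "f1 w = 0" "f1 x = 0" "0 < f1 x'"
    and f2: "affine_fun f2" "\<forall>p\<in>K. 0 \<le> f2 p" "f2 v = 0" "f2 w = 0" "f2 x' = 0" "0 < f2 x"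
    and l: "l \<in> arc_edges c" and vK': "v \<in> flat K c w"
  shows "cut_step\<^sup>*\<^sup>* (flat K c w) (flat K c w \<inter> {p. 0 \<le> tilt l v p})"
proof (cases "\<exists>p\<in>flat K c w. tilt l v p < 0")
  case False
  then have "flat K c w \<inter> {p. 0 \<le> tilt l v p} = flat K c w" by force
  then show ?thesis by simp
next
  case True
  define K' where "K' = flat K c w"
  define \<Phi>' where "\<Phi>' = \<Phi> \<union> (\<lambda>l. tilt l w) ` arc_edges c"
  have capK': "cap_by \<Phi>' K'" unfolding K'_def \<Phi>'_def by (rule cap_by_flat[OF K])
  note cD = cap_byD[OF K] and cD' = cap_byD[OF capK']
  note cd = chordD[OF ch]
  have lL: "l \<in> L" using l unfolding arc_edges_def by blast
  have w0: "g w \<noteq> 0" using w by simp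
  have K'K: "K' \<subseteq> K" unfolding K'_def flat_def by blast
  have convK: "convex K" using cap_by_polytope[OF K] polytope_imp_convex by blast
  have affl: "affine_fun (tilt l v)" by (rule affine_tilt[OF affine_L[OF lL]])
  define P where "P = K' \<inter> {p. tilt l v p \<le> 0}"
  have polyP: "polytope P" unfolding P_def
    by (rule polytope_Int_polyhedron[OF cap_by_polytope[OF capK'] affine_fun_level(2)[OF affl]])
  have gpos: "0 < g p" if "p \<in> K'" "tilt l v p < 0" for p
  proof (rule ccontr)
    assume "\<not> 0 < g p"
    then have "g p = 0" using cD'(7)[OF that(1)] by simp
    then have "p \<in> X" "tilt l v p = l p" using cD'(5) that tilt_base by auto
    then show False using L_nonneg[OF lL] that by force
  qed
  have active: "f w = 0" if p: "p \<in> K'" "tilt l v p < 0" and f: "f \<in> \<Phi>" "f p = 0" for p f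
  proof -
    have pK: "p \<in> K" using p K'K by blast
    have af: "affine_fun f" "\<forall>p\<in>K. 0 \<le> f p" using cD(2,8) f unfolding vertex_fun_def by auto
    \<comment> \<open>Contraposition of \<open>arc_local\<close>: beyond the plane of an arc edge
      means beyond the chord plane.\<close>
    have "tilt c v p < 0"
      using arc_local[OF ch v(2) convK cD(6) cD(7) v(3,4) pK _ l] p by force
    then show ?thesis
    \<comment> \<open>Between the two chord planes \<open>p\<close> is in the tetrahedron
      \<open>x x' v w\<close>; beyond the second it is in the cone from \<open>w\<close> over
      \<open>X\<close>.\<close>
    proof (cases "0 \<le> tilt c w p")
      case True
      show ?thesis
        by (rule tetrahedron_active[OF ch v(1,2) w cD(6) f1 f2 pK _ True af f(2)]) fact
    next
      case False
      have "0 \<le> tilt l w p" if "l \<in> arc_edges c" for l using p(1) that unfolding K'_def flat_def by blast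
      then obtain d z where d: "0 < d" "d < 1" "z \<in> X" "p = d *\<^sub>R w + (1 - d) *\<^sub>R z"
        using cone_over_arc[OF ch w(2) gpos[OF p]] False by (metis not_le)
      have "f p = d * f w + (1 - d) * f z" unfolding d(4) by (rule affine_fun_comb2[OF af(1)]) simp
      moreover have "0 \<le> f w" "0 \<le> f z" using af(2) w(1) d(3) cD(6) by blast+
      then have "0 \<le> d * f w" "0 \<le> (1 - d) * f z" using d by simp_all
      ultimately have "d * f w = 0" using f(2) by linarith
      then show ?thesis using d by simp
    qed
  qed
  have ext: "p = w" if p: "p extreme_point_of P" "tilt l v p < 0" for p
  proof -
    define \<Psi> where "\<Psi> = insert (\<lambda>p. - tilt l v p) (insert g \<Phi>')"
    have pP: "p \<in> K'" using p(1) unfolding extreme_point_of_def P_def by blast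
    have "P = {p. \<forall>f\<in>\<Psi>. 0 \<le> f p}" unfolding P_def \<Psi>_def by (subst cD'(3)) auto
    moreover have "finite \<Psi>" unfolding \<Psi>_def using cD'(1) by simp
    moreover have "affine_fun f" if "f \<in> \<Psi>" for f
      using that cD'(2) affine_g affine_fun_minus[OF affl] unfolding \<Psi>_def vertex_fun_def by blast
    moreover have "f w = 0" if f: "f \<in> \<Psi>" "f p = 0" for f
    proof -
      have "f \<in> \<Phi>'" using f p gpos[OF pP p(2)] unfolding \<Psi>_def by auto
      then consider "f \<in> \<Phi>" | l where "f = tilt l w" unfolding \<Phi>'_def by blast
      then show ?thesis
        using active[of p f, OF pP p(2) _ f(2)] tilt_self[OF w0] by cases auto
    qed
    ultimately show ?thesis using extreme_point_active[OF _ _ _ p(1)] by blast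
  qed
  define Q where "Q = K' \<inter> {p. tilt l v p = 0}"
  have PQ: "P = convex hull {p. p extreme_point_of P}"
    by (rule Krein_Milman_Minkowski) (use polyP polytope_imp_compact polytope_imp_convex in auto)
  \<comment> \<open>If \<open>w\<close> were not beyond the plane, neither would be any extreme
    point of the piece.\<close>
  have wl: "tilt l v w < 0"
  proof (rule ccontr)
    assume "\<not> tilt l v w < 0"
    then have "0 \<le> tilt l v p" if "p extreme_point_of P" for p using ext[OF that] by force
    then have "0 \<le> tilt l v p" if "p \<in> P" for p
      using affine_fun_nonneg_hull[OF affl, of "{p. p extreme_point_of P}" p] PQ that by auto
    then show False using True unfolding P_def K'_def by force
  qed
  have wK': "w \<in> K'" unfolding K'_def flat_def using w tilt_self[OF w0] by simp
  have "P = convex hull (insert w Q)"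
  proof
    have "{p. p extreme_point_of P} \<subseteq> insert w Q"
    proof
      fix p assume "p \<in> {p. p extreme_point_of P}"
      then have p: "p extreme_point_of P" by simp
      then have "p \<in> K'" "tilt l v p \<le> 0" unfolding extreme_point_of_def P_def by auto
      then show "p \<in> insert w Q" using ext[OF p] unfolding Q_def by force
    qed
    then show "P \<subseteq> convex hull (insert w Q)" using PQ hull_mono by metis
    have "insert w Q \<subseteq> P" using wl wK' unfolding P_def Q_def by auto
    then show "convex hull (insert w Q) \<subseteq> P"
      using polytope_imp_convex[OF polyP] by (rule hull_minimal)
  qed
  then have "cut_step K' (K' \<inter> {p. 0 \<le> tilt l v p})"
    unfolding cut_step_def P_def Q_def using lL vK' wK' v(2) wl unfolding K'_def by blast
  then show ?thesis unfolding K'_def by blast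
qed

section \<open>Flattening along an arc\<close>

text \<open>The chords \<open>xy\<close> and \<open>yx'\<close> are treated in turn; each has fewer
  vertices of \<open>X\<close> beyond it because \<open>y\<close> now lies on it. The functional
  \<open>h\<close> and the old witnesses separate the new ends, unless nothing lies beyond the new
  plane.\<close>

lemma cut_split:
  assumes K: "cap_by \<Phi> K" and ch: "chord c x x'"
    and v: "v extreme_point_of K" "0 < g v" "sep K v x x'" "sep K v x' x"
    and y: "y extreme_point_of X" "c y < 0"
    and h: "affine_fun h" "\<forall>p\<in>K. 0 \<le> h p" "h v = 0" "h y = 0" "\<exists>q\<in>X. 0 < h q"
    and IH: "\<And>\<Phi> K c' a b. cap_by \<Phi> K \<Longrightarrow> chord c' a b \<Longrightarrow> v extreme_point_of K \<Longrightarrow>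
       sep K v a b \<Longrightarrow> sep K v b a \<Longrightarrow>
       card {z. z extreme_point_of X \<and> c' z < 0} < card {z. z extreme_point_of X \<and> c z < 0} \<Longrightarrow>
       cut_step\<^sup>*\<^sup>* K (flat K c' v)"
  shows "cut_step\<^sup>*\<^sup>* K (flat K c v)"
proof -
  note cD = cap_byD[OF K] and cd = chordD[OF ch]
  have v0: "g v \<noteq> 0" using v by simp
  have vK: "v \<in> K" using v by (simp add: extreme_point_of_def)
  have yX: "y \<in> X" using y extreme_in_X by blast
  obtain c1 c2 where aff: "affine_fun c1" "affine_fun c2"
    and vals: "c1 x = 0" "c1 y = 0" "c1 x' = 1" "c2 x = 1" "c2 y = 0" "c2 x' = 0"
    and co: "\<And>b. g b = 0 \<Longrightarrow> b = c2 b *\<^sub>R x + c1 b *\<^sub>R x' + (c b / c y) *\<^sub>R y"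
    "\<And>b. g b = 0 \<Longrightarrow> c2 b + c1 b + c b / c y = (1::real)"
    by (rule plane_coordinates[OF ch yX]) (use y in auto)
  have sp: "arc_edges c = arc_edges c1 \<union> arc_edges c2" "\<And>b. b \<in> X \<Longrightarrow> c1 b < 0 \<Longrightarrow> c b < 0"
    "\<And>b. b \<in> X \<Longrightarrow> c2 b < 0 \<Longrightarrow> c b < 0" "chord c1 x y" "chord c2 y x'"
    by (rule arc_split[OF ch y aff vals co]; assumption)+
  have card: "card {z. z extreme_point_of X \<and> c' z < 0} < card {z. z extreme_point_of X \<and> c z < 0}"
    if "\<And>b. b \<in> X \<Longrightarrow> c' b < 0 \<Longrightarrow> c b < 0" "c' y = 0" for c' :: "real^3 \<Rightarrow> real"
  proof (rule psubset_card_mono)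
    show "finite {z. z extreme_point_of X \<and> c z < 0}" using finite_extreme_X by simp
    show "{z. z extreme_point_of X \<and> c' z < 0} \<subset> {z. z extreme_point_of X \<and> c z < 0}"
    proof (rule psubsetI)
      show "{z. z extreme_point_of X \<and> c' z < 0} \<subseteq> {z. z extreme_point_of X \<and> c z < 0}"
        using that(1) extreme_in_X by blast
      have "y \<notin> {z. z extreme_point_of X \<and> c' z < 0}" "y \<in> {z. z extreme_point_of X \<and> c z < 0}"
        using that(2) y by auto
      then show "{z. z extreme_point_of X \<and> c' z < 0} \<noteq> {z. z extreme_point_of X \<and> c z < 0}" by blast
    qed
  qed
  obtain f where f: "affine_fun f" "\<forall>p\<in>K. 0 \<le> f p" "f v = 0" "f x = 0" "0 < f x'"
    using v(3) unfolding sep_def by blast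
  obtain f' where f': "affine_fun f'" "\<forall>p\<in>K. 0 \<le> f' p" "f' v = 0" "f' x' = 0" "0 < f' x"
    using v(4) unfolding sep_def by blast
  have 1: "cut_step\<^sup>*\<^sup>* K (flat K c1 v)"
  proof -
    have "(sep K v x y \<and> sep K v y x) \<or> (\<forall>p\<in>K. 0 \<le> tilt c1 v p)"
      by (rule sep_or_trivial[OF sp(4) v(2) cD(6) f(1-4) _ h cd(8)]) (use f cd vals in auto)
    then show ?thesis
      using IH[OF K sp(4) v(1) _ _ card[of c1, OF sp(2) vals(2)]] flat_trivial[OF sp(4) v(2) cD(6)] by auto
  qed
  define K1 where "K1 = flat K c1 v"
  have K1: "K1 \<subseteq> K" unfolding K1_def flat_def by blast
  have cap1: "cap_by (\<Phi> \<union> (\<lambda>l. tilt l v) ` arc_edges c1) K1" unfolding K1_def by (rule cap_by_flat[OF K])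
  have "v \<in> K1" unfolding K1_def flat_def using vK tilt_self[OF v0] by simp
  then have v1: "v extreme_point_of K1" using extreme_point_of_subset[OF v(1) K1] by blast
  have 2: "cut_step\<^sup>*\<^sup>* K1 (flat K1 c2 v)"
  proof -
    have "(sep K1 v y x' \<and> sep K1 v x' y) \<or> (\<forall>p\<in>K1. 0 \<le> tilt c2 v p)"
      by (rule sep_or_trivial[OF sp(5) v(2) cap_byD(6)[OF cap1] h(1) _ h(3-5) f'(1) _ f'(3,4) _ cd(7)])
        (use f' h cd vals K1 in auto)
    then show ?thesis
      using IH[OF cap1 sp(5) v1 _ _ card[of c2, OF sp(3) vals(5)]]
        flat_trivial[OF sp(5) v(2) cap_byD(6)[OF cap1]] by auto
  qed
  have "flat K1 c2 v = flat K c v" unfolding K1_def flat_def sp(1) by auto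
  then show ?thesis using 1 2 unfolding K1_def by simp
qed

text \<open>First the arc is flattened to \<open>w\<close>, then the pyramid beyond the plane of
  \<open>l\<close> and \<open>v\<close> is removed. That plane now supports the rest and contains
  \<open>v\<close> and the ends of \<open>l\<close>, so the chord can be split at such an
  end.\<close>

lemma cut_edge:
  assumes K: "cap_by \<Phi> K" and ch: "chord c x x'"
    and v: "v extreme_point_of K" "0 < g v" "sep K v x x'" "sep K v x' x"
    and w: "w extreme_point_of K" "0 < g w" "tilt c v w < 0"
    and f1: "affine_fun f1" "\<forall>p\<in>K. 0 \<le> f1 p" "f1 v = 0" "f1 w = 0" "f1 x = 0" "0 < f1 x'"
    and f2: "affine_fun f2" "\<forall>p\<in>K. 0 \<le> f2 p" "f2 v = 0" "f2 w = 0" "f2 x' = 0" "0 < f2 x"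
    and l: "l \<in> arc_edges c"
    and IH: "\<And>\<Phi> K c' a b. cap_by \<Phi> K \<Longrightarrow> chord c' a b \<Longrightarrow> v extreme_point_of K \<Longrightarrow>
       sep K v a b \<Longrightarrow> sep K v b a \<Longrightarrow>
       card {z. z extreme_point_of X \<and> c' z < 0} < card {z. z extreme_point_of X \<and> c z < 0} \<Longrightarrow>
       cut_step\<^sup>*\<^sup>* K (flat K c' v)"
    and IHw: "cut_step\<^sup>*\<^sup>* K (flat K c w)"
  shows "cut_step\<^sup>*\<^sup>* K (flat K c v)"
proof -
  note cD = cap_byD[OF K] and cd = chordD[OF ch]
  have vw0: "g v \<noteq> 0" "g w \<noteq> 0" using v w by auto
  have vK: "v \<in> K" and wK: "w \<in> K" using v w by (simp_all add: extreme_point_of_def)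
  have lL: "l \<in> L" using l unfolding arc_edges_def by blast
  have convK: "convex K" using cap_by_polytope[OF K] polytope_imp_convex by blast
  have sepw: "sep K w x x'" "sep K w x' x" using f1 f2 unfolding sep_def by blast+
  have "0 < tilt c w v" unfolding tilt_swap[OF vw0]
    using v w by (simp add: mult_pos_neg divide_neg_pos)
  then have tv: "0 \<le> tilt l' w v" if "l' \<in> arc_edges c" for l'
    using arc_local[OF ch w(2) convK cD(6,7) sepw vK _ that] by simp
  then have vK': "v \<in> flat K c w" unfolding flat_def using vK by simp
  define K2 where "K2 = flat K c w \<inter> {p. 0 \<le> tilt l v p}"
  have s2: "cut_step\<^sup>*\<^sup>* (flat K c w) K2" unfolding K2_def
    by (rule pyramid_cut[OF K ch vK v(2-4) wK w(2,3) f1 f2 l vK'])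
  have K2K: "K2 \<subseteq> K" unfolding K2_def flat_def by blast
  have K2eq: "K2 = flat K c w \<inter> {p. \<forall>f\<in>{tilt l v}. 0 \<le> f p}" unfolding K2_def by simp
  have cap2: "cap_by ((\<Phi> \<union> (\<lambda>l. tilt l w) ` arc_edges c) \<union> {tilt l v}) K2" unfolding K2eq
    by (rule cap_by_cut[OF cap_by_flat[OF K]]) (use vertex_fun_tilt[OF lL] in auto)
  have "v \<in> K2" unfolding K2_def using vK' tilt_self[OF vw0(1)] by simp
  then have v2: "v extreme_point_of K2" using extreme_point_of_subset[OF v(1) K2K] by blast
  have affl: "affine_fun (tilt l v)" by (rule affine_tilt[OF affine_L[OF lL]])
  have s3: "cut_step\<^sup>*\<^sup>* K2 (flat K2 c v)"
  proof (cases "\<exists>y. y extreme_point_of X \<and> l y = 0 \<and> c y < 0")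
    case True
    then obtain y where y: "y extreme_point_of X" "l y = 0" "c y < 0" by blast
    have ty: "tilt l v y = 0" using y extreme_in_X by (simp add: tilt_base g_X)
    obtain q where q: "q \<in> X" "0 < l q" using pos_L[OF lL] by blast
    then have tq: "\<exists>q\<in>X. 0 < tilt l v q" by (auto simp: tilt_base g_X intro!: bexI[of _ q])
    have nn: "\<forall>p\<in>K2. 0 \<le> tilt l v p" by (simp add: K2_def)
    show ?thesis
      by (rule cut_split[OF cap2 ch v2 v(2) sep_subset[OF v(3) K2K] sep_subset[OF v(4) K2K]
            y(1,3) affl nn tilt_self[OF vw0(1)] ty tq]) (rule IH)
  next
    case False
    \<comment> \<open>No end of \<open>l\<close> is strictly beyond the chord, so the edge lies on
      the chord and its plane is the only one to be moved.\<close>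
    then have "0 \<le> c b" if "b \<in> X" "l b = 0" for b
      using edge_nonneg_if_extreme[OF lL cd(1) _ that] by force
    then have nn: "\<forall>q\<in>X. 0 \<le> c q" using l unfolding arc_edges_def by force
    obtain k where k: "0 < k" "\<And>p. tilt l v p = k * tilt c v p"
      using arc_supporting_chord[OF cd(1,9) nn l] vw0(1) by metis
    have "\<forall>p\<in>K2. 0 \<le> tilt c v p" unfolding K2_def using k by (auto simp: zero_le_mult_iff)
    then have "flat K2 c v = K2" by (rule flat_trivial[OF ch v(2) cap_byD(6)[OF cap2]])
    then show ?thesis by simp
  qed
  \<comment> \<open>As \<open>v\<close> is on the inner side of the planes through \<open>w\<close>,
    the planes through \<open>v\<close> cut at least as deep, and the earlier cuts do not change the
    result.\<close>
  have "flat K2 c v = flat K c v"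
  proof
    show "flat K2 c v \<subseteq> flat K c v" unfolding flat_def using K2K by blast
    show "flat K c v \<subseteq> flat K2 c v"
    proof
      fix p assume p: "p \<in> flat K c v"
      have pK: "p \<in> K" using p unfolding flat_def by blast
      have "0 \<le> tilt l' w p" if l': "l' \<in> arc_edges c" for l'
      proof -
        have "0 \<le> (l' v / g v - l' w / g w) * g v"
          using tv[OF l'] tilt_shift[of l' w v v] tilt_self[OF vw0(1), of l'] by simp
        then have "0 \<le> l' v / g v - l' w / g w" using v(2) by (simp add: zero_le_mult_iff)
        then have "0 \<le> (l' v / g v - l' w / g w) * g p" using cD(7)[OF pK] by simp
        moreover have "0 \<le> tilt l' v p" using p l' unfolding flat_def by blast
        ultimately show ?thesis unfolding tilt_shift[of l' w p v] by linarith
      qed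
      then show "p \<in> flat K2 c v" using p l pK unfolding K2_def flat_def by blast
    qed
  qed
  then show ?thesis using IHw s2 s3 by simp
qed

text \<open>Functionals vanishing at \<open>x\<close>, \<open>v\<close>, \<open>w\<close> are
  multiples of the barycentric coordinate of \<open>x'\<close>. Hence a facet through these three
  points is unique and misses \<open>x'\<close>.\<close>

lemma multiple_of_edge_functional:
  assumes ch: "chord c x x'" and v: "g v \<noteq> 0" and w: "tilt c v w \<noteq> 0"
    and f: "affine_fun f" "f x = 0" "f v = 0" "f w = 0" "f q \<noteq> 0"
  obtains B where "affine_fun B" "\<And>p. f p = f x' * B p" "f x' \<noteq> 0"
    "\<And>h p. affine_fun h \<Longrightarrow> h x = 0 \<Longrightarrow> h v = 0 \<Longrightarrow> h w = 0 \<Longrightarrow> h p = h x' * B p"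
proof -
  note cd = chordD[OF ch]
  have tx: "tilt c v x = 0" "tilt c v x' = 0" "tilt c v v = 0"
    using cd g_X v by (simp_all add: tilt_base tilt_self)
  obtain A B C D where co: "affine_fun B" "\<And>p. A p + B p + C p + D p = (1::real)"
    "\<And>p. p = A p *\<^sub>R x + B p *\<^sub>R x' + C p *\<^sub>R v + D p *\<^sub>R w"
    using barycentric_coordinates[OF affine_tilt[OF cd(1)] tx w affine_g g_X[OF cd(7)] g_X[OF cd(8)]
        v cd(4)]
    by metis
  have all: "h p = h x' * B p" if "affine_fun h" "h x = 0" "h v = 0" "h w = 0" for h p
  proof -
    have "h p = A p * h x + B p * h x' + C p * h v + D p * h w"
      using affine_fun_comb4[OF that(1) co(2)] co(3) by metis
    then show ?thesis using that by simp
  qed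
  moreover have "f x' \<noteq> 0" using all[OF f(1-4), of q] f(5) by auto
  ultimately show thesis using that co(1) f by blast
qed

text \<open>Outer induction on the number of vertices of \<open>X\<close> beyond the chord, inner
  induction on the number of vertices of \<open>K\<close> beyond the chord plane through
  \<open>v\<close>.\<close>

lemma cut_arc:
  assumes "cap_by \<Phi> K" "chord c x x'" "v extreme_point_of K" "0 < g v" "sep K v x x'" "sep K v x' x"
  shows "cut_step\<^sup>*\<^sup>* K (flat K c v)"
  using assms
proof (induction "card {z. z extreme_point_of X \<and> c z < 0}" arbitrary: \<Phi> K c x x' v rule: less_induct)
  case less
  note outer = less.hyps
  note K = less.prems(1) and ch = less.prems(2)
  have IH: "cut_step\<^sup>*\<^sup>* K' (flat K' c' v)"
    if "cap_by \<Phi>' K'" "chord c' a b" "v extreme_point_of K'" "0 < g v" "sep K' v a b" "sep K' v b a"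
      "card {z. z extreme_point_of X \<and> c' z < 0} < card {z. z extreme_point_of X \<and> c z < 0}"
    for \<Phi>' K' c' a b v
    using outer[OF that(7) that(1-6)] .
  note cD = cap_byD[OF K] and cd = chordD[OF ch]
  have polyK: "polytope K" by (rule cap_by_polytope[OF K])
  have convK: "convex K" using polyK polytope_imp_convex by blast
  have finK: "finite {p. p extreme_point_of K}"
    by (rule finite_polyhedron_extreme_points[OF polytope_imp_polyhedron[OF polyK]])
  from less.prems(3-6) show ?case
  proof (induction "card {p. p extreme_point_of K \<and> tilt c v p < 0}" arbitrary: v rule: less_induct)
    case less
    note v = less.prems
    have vK: "v \<in> K" using v by (simp add: extreme_point_of_def)
    have v0: "g v \<noteq> 0" using v by simp
    show ?case
    proof (cases "\<forall>p\<in>K. \<forall>l\<in>arc_edges c. 0 \<le> tilt l v p")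
      case True
      then have "flat K c v = K" unfolding flat_def by blast
      then show ?thesis by simp
    next
      case False
      then obtain p0 l where p0: "p0 \<in> K" "l \<in> arc_edges c" "tilt l v p0 < 0" by force
      have cp0: "tilt c v p0 < 0"
        using arc_local[OF ch v(2) convK cD(6,7) v(3,4) p0(1) _ p0(2)] p0(3) by force
      show ?thesis
      proof (cases "\<exists>y h. y extreme_point_of X \<and> c y < 0 \<and> affine_fun h \<and> (\<forall>p\<in>K. 0 \<le> h p) \<and>
          h v = 0 \<and> h y = 0 \<and> (\<exists>q\<in>X. 0 < h q)")
        case True
        then obtain y h where y: "y extreme_point_of X" "c y < 0"
          and h: "affine_fun h" "\<forall>p\<in>K. 0 \<le> h p" "h v = 0" "h y = 0" "\<exists>q\<in>X. 0 < h q" by blast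
        show ?thesis
          by (rule cut_split[OF K ch v y h]) (use IH v(2) in blast)
      next
        case False
        then have unseen: False if "y extreme_point_of X" "c y < 0" "affine_fun h" "\<forall>p\<in>K. 0 \<le> h p"
          "h v = 0" "h y = 0" "\<exists>q\<in>X. 0 < h q" for y h
          using that by blast
        obtain a b where ab: "\<And>p. tilt c v p = a \<bullet> p + b"
          using affine_tilt[OF cd(1)] unfolding affine_fun_def by metis
        have "a \<bullet> p0 < a \<bullet> v" using ab[of p0] ab[of v] cp0 tilt_self[OF v0, of c] by linarith
        then obtain S w where S: "S face_of K" "aff_dim S = 1" "v \<in> S" "w \<in> S"
          and w: "w extreme_point_of K" "a \<bullet> w < a \<bullet> v"
          using polytope_edge_descending[OF polyK v(1) p0(1)] by metis
        have tw: "tilt c v w < 0" using ab[of w] ab[of v] w tilt_self[OF v0, of c] by linarith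
        have wK: "w \<in> K" using w by (simp add: extreme_point_of_def)
        note dim = cap_by_aff_dim[OF K vK v(2)]
        obtain F F' where F: "F facet_of K" "F' facet_of K" "F \<noteq> F'" "S \<subseteq> F" "S \<subseteq> F'"
          using edge_two_facets[OF polyK S(1,2) dim(1)] by blast
        have FX: "F \<noteq> X" "F' \<noteq> X" using F S v0 g_X by blast+
        obtain f where f: "f \<in> \<Phi>" "F = K \<inter> {p. f p = 0}"
          using facet_functional[OF K dim(2) F(1) FX(1)] by blast
        obtain f' where f': "f' \<in> \<Phi>" "F' = K \<inter> {p. f' p = 0}"
          using facet_functional[OF K dim(2) F(2) FX(2)] by blast
        have props: "affine_fun f" "\<forall>p\<in>K. 0 \<le> f p" "\<exists>q\<in>X. 0 < f q"
           "\<exists>z. z extreme_point_of X \<and> f z = 0" if "f \<in> \<Phi>" for f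
          using cD(2,8)[OF that] unfolding vertex_fun_def by blast+
        have zero: "f v = 0" "f w = 0" "f' v = 0" "f' w = 0" using F S f f' by auto
        \<comment> \<open>A vertex \<open>w\<close> on the base would be beyond the chord and joined
          to \<open>v\<close> along the facet \<open>F\<close>, the case already excluded.\<close>
        have gw: "0 < g w"
        proof (rule ccontr)
          assume "\<not> 0 < g w"
          then have "g w = 0" using cD(7)[OF wK] by simp
          then have "w \<in> X" using cD(5) wK by blast
          then have "w extreme_point_of X" "c w < 0"
            using extreme_point_of_subset[OF w(1) cD(6)] tw by (auto simp: tilt_base g_X)
          then show False using unseen[of w f] props(1-3)[OF f(1)] zero by blast
        qed
        \<comment> \<open>The facet touches \<open>X\<close> at a vertex \<open>z\<close>. If it
          missed \<open>x\<close> and \<open>x'\<close>, then \<open>z\<close> would be strictly on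
          the side \<open>c > 0\<close>, and the segment \<open>wz\<close> would meet the triangle
          \<open>x x' v\<close> at \<open>v\<close>, which is a vertex.\<close>
        have touch: "h x = 0 \<or> h x' = 0" if h: "h \<in> \<Phi>" "h v = 0" "h w = 0" for h
        proof (rule ccontr)
          assume "\<not> ?thesis"
          then have hx: "0 < h x" "0 < h x'"
            using props(2)[OF h(1)] cD(6) cd(7,8) by (metis less_eq_real_def subsetD)+
          obtain z where z: "z extreme_point_of X" "h z = 0" using props(4)[OF h(1)] by blast
          have "\<not> c z < 0" using unseen[OF z(1) _ props(1,2)[OF h(1)] h(2) z(2) props(3)[OF h(1)]] by blast
          moreover have "c z \<noteq> 0" using chord_extreme[OF ch z(1)] z(2) hx by auto
          ultimately have cz: "0 < c z" by simp
          have zX: "z \<in> X" using z extreme_in_X by blast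
          define t where "t = - tilt c v w / (c z - tilt c v w)"
          have t: "0 < t" "t < 1" unfolding t_def using tw cz by (auto simp: field_simps)
          define r where "r = (1 - t) *\<^sub>R w + t *\<^sub>R z"
          have ev: "f r = (1 - t) * f w + t * f z" if "affine_fun f" for f
            unfolding r_def by (rule affine_fun_comb2[OF that]) simp
          have rK: "r \<in> K" unfolding r_def
            by (rule convexD[OF convK wK]) (use zX cD(6) t in auto)
          have "tilt c v r = tilt c v w + t * (c z - tilt c v w)"
            using ev[OF affine_tilt[OF cd(1)], of v] zX by (simp add: tilt_base g_X algebra_simps)
          also have "\<dots> = 0" unfolding t_def using tw cz by simp
          finally obtain i j k where i: "0 \<le> i" "0 \<le> j" "0 \<le> k" "i + j + k = (1::real)"
            "r = i *\<^sub>R x + j *\<^sub>R x' + k *\<^sub>R v"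
            using slice_triangle[OF ch v(2) cD(7) v(3,4) rK] by blast
          have "h r = 0" using ev[OF props(1)[OF h(1)]] h z by simp
          moreover have "h r = i * h x + j * h x'"
            using affine_fun_comb3[OF props(1)[OF h(1)] i(4)] i(5) h by simp
          moreover have "0 \<le> i * h x" "0 \<le> j * h x'" using i hx by simp_all
          ultimately have "i * h x = 0" "j * h x' = 0" by linarith+
          then have "r = v" using hx i by simp
          then have "v = (1 - t) *\<^sub>R w + t *\<^sub>R z" unfolding r_def by simp
          then have "z = v"
            using extreme_point_not_comb2[OF v(1) convK wK _ _, of z "1 - t" t] zX cD(6) t by auto
          then show False using v0 g_X zX by simp
        qed
        have IHw: "cut_step\<^sup>*\<^sup>* K (flat K c w)" if "sep K w x x'" "sep K w x' x"
        proof (rule less.hyps[OF _ w(1) gw that])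
          \<comment> \<open>Passing from \<open>v\<close> to \<open>w\<close> raises the tilted
            functional off the base, so no vertex is newly beyond the plane, and \<open>w\<close>
            itself no longer is.\<close>
          have lt: "0 < c v / g v - c w / g w"
          proof -
            have "(c w / g w - c v / g v) * g w < 0"
              using tilt_shift[of c v w w] tw tilt_self[of w c] gw by simp
            then show ?thesis using gw by (simp add: mult_less_0_iff)
          qed
          show "card {p. p extreme_point_of K \<and> tilt c w p < 0} < card {p. p extreme_point_of K \<and> tilt c v p < 0}"
          proof (rule psubset_card_mono)
            show "finite {p. p extreme_point_of K \<and> tilt c v p < 0}" using finK by simp
            have "tilt c v p < 0" if "p extreme_point_of K" "tilt c w p < 0" for p
            proof -
              have "0 \<le> (c v / g v - c w / g w) * g p"
                using lt cD(7) that(1) unfolding extreme_point_of_def by simp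
              then show ?thesis using that(2) tilt_shift[of c w p v] by linarith
            qed
            then show "{p. p extreme_point_of K \<and> tilt c w p < 0} \<subset> {p. p extreme_point_of K \<and> tilt c v p < 0}"
              using w(1) tw tilt_self[of w c] gw by force
          qed
        qed
        have final: "cut_step\<^sup>*\<^sup>* K (flat K c v)"
          if h: "h \<in> \<Phi>" "h v = 0" "h w = 0" "h x = 0" and h': "h' \<in> \<Phi>" "h' v = 0" "h' w = 0" "h' x' = 0" for h h'
        proof -
          have "h x' \<noteq> 0"
            using multiple_of_edge_functional[OF ch v0 _ props(1)[OF h(1)] h(4,2,3)] tw props(3)[OF h(1)]
            by (metis less_irrefl)
          then have hx: "0 < h x'" using props(2)[OF h(1)] cD(6) cd(8) by (metis less_eq_real_def subsetD)
          have "h' x \<noteq> 0"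
            using multiple_of_edge_functional[OF chord_sym[OF ch] v0 _ props(1)[OF h'(1)] h'(4,2,3)] tw props(3)[OF h'(1)]
            by (metis less_irrefl)
          then have hx': "0 < h' x" using props(2)[OF h'(1)] cD(6) cd(7) by (metis less_eq_real_def subsetD)
          have "sep K w x x'" "sep K w x' x" using h h' hx hx' props unfolding sep_def by blast+
          then show ?thesis
            by (intro cut_edge[OF K ch v w(1) gw tw props(1,2)[OF h(1)] h(2-4) hx
                  props(1,2)[OF h'(1)] h'(2-4) hx' p0(2)] IHw) (use IH v(2) in blast)+
        qed
        \<comment> \<open>Facets through \<open>v\<close>, \<open>w\<close> and the same chord end
          are cut out by proportional functionals.\<close>
        have same: "F = F'" if ch: "chord c a b" and fa: "f a = 0" "f' a = 0" for a b
        proof -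
          have tw': "tilt c v w \<noteq> 0" using tw by simp
          obtain q q' where q: "f q \<noteq> 0" "f' q' \<noteq> 0" using props(3) f f' by (metis less_irrefl)
          obtain B where B: "\<And>p. f p = f b * B p" "f b \<noteq> 0"
            "\<And>h p. affine_fun h \<Longrightarrow> h a = 0 \<Longrightarrow> h v = 0 \<Longrightarrow> h w = 0 \<Longrightarrow> h p = h b * B p"
            using multiple_of_edge_functional[OF ch v0 tw' props(1)[OF f(1)] fa(1) zero(1,2) q(1)] by metis
          have B': "f' p = f' b * B p" for p
            by (rule B(3)[OF props(1)[OF f'(1)] fa(2) zero(3,4)])
          have "f' b \<noteq> 0" using B'[of q'] q by auto
          then have "f p = 0 \<longleftrightarrow> f' p = 0" for p
            unfolding B(1)[of p] B'[of p] using B(2) by simp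
          then show ?thesis using f f' by auto
        qed
        have "f x = 0 \<or> f x' = 0" "f' x = 0 \<or> f' x' = 0" using touch f f' zero by auto
        moreover have "\<not> (f x = 0 \<and> f' x = 0)" "\<not> (f x' = 0 \<and> f' x' = 0)"
          using same[OF ch] same[OF chord_sym[OF ch]] F(3) by auto
        ultimately show ?thesis using final[of f f'] final[of f' f] f f' zero by blast
      qed
    qed
  qed
qed

end

section \<open>The partition\<close>

context dome_base
begin

lemma chord_exists:
  assumes x: "x extreme_point_of X" and y: "y extreme_point_of X" and xy: "x \<noteq> y"
  obtains c where "chord c x y"
proof -
  have "\<not> X \<subseteq> affine hull {x, y}"
  proof
    assume "X \<subseteq> affine hull {x, y}"
    then have "aff_dim X \<le> aff_dim (affine hull {x, y})" by (rule aff_dim_subset)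
    then show False using aff_dim_X xy by (simp add: aff_dim_affine_hull aff_dim_2)
  qed
  then obtain z where z: "z \<in> X" "z \<notin> affine hull {x, y}" by blast
  \<comment> \<open>Orthogonal projection: \<open>u\<close> is the component of \<open>z - x\<close>
    orthogonal to \<open>y - x\<close>, so the functional with gradient \<open>u\<close> separates
    \<open>z\<close> from the line \<open>xy\<close>.\<close>
  define k where "k = ((z - x) \<bullet> (y - x)) / ((y - x) \<bullet> (y - x))"
  define u where "u = (z - x) - k *\<^sub>R (y - x)"
  have "k * ((y - x) \<bullet> (y - x)) = (z - x) \<bullet> (y - x)"
    unfolding k_def by (rule nonzero_eq_divide_eq[THEN iffD1, OF _ refl]) (use xy in simp)
  then have uo: "u \<bullet> (y - x) = 0"
    unfolding u_def inner_diff_left[of "z - x"] inner_scaleR_left by linarith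
  have "u \<noteq> 0"
  proof
    assume "u = 0"
    then have "z = (1 - k) *\<^sub>R x + k *\<^sub>R y" unfolding u_def by (simp add: algebra_simps)
    then have "z \<in> affine hull {x, y}" unfolding affine_hull_2 by (intro CollectI exI[of _ "1 - k"] exI[of _ k]) simp
    then show False using z by simp
  qed
  define c where "c = (\<lambda>p. u \<bullet> p + (- (u \<bullet> x)))"
  have "affine_fun c" unfolding affine_fun_def c_def by blast
  moreover have "c x = 0" "c y = 0" unfolding c_def using uo by (simp_all add: inner_diff_right)
  moreover have "c z = u \<bullet> u + k * (u \<bullet> (y - x))"
    unfolding c_def u_def by (simp add: inner_diff_right inner_add_right algebra_simps)
  then have "c z \<noteq> 0" using uo \<open>u \<noteq> 0\<close> by simp
  ultimately show thesis using that x y xy z unfolding chord_def by blast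
qed

lemma X_face:
  assumes K: "cap_by \<Phi> K" shows "X face_of K"
proof -
  have "(K \<inter> {p. g p = 0}) face_of K"
    by (rule affine_fun_face[OF affine_g polytope_imp_convex[OF cap_by_polytope[OF K]] cap_byD(7)[OF K]])
  then show ?thesis unfolding cap_byD(5)[OF K] .
qed

text \<open>An edge leads from a vertex \<open>x\<close> of \<open>X\<close> up to \<open>w\<close>,
  and a facet at \<open>w\<close> avoiding \<open>x\<close> touches \<open>X\<close> at another
  vertex \<open>y\<close>. Flattening to \<open>w\<close> on both sides of the chord
  \<open>xy\<close> leaves the pyramid over \<open>X\<close>.\<close>

lemma cap_reaches_pyramid:
  assumes K: "cap_by \<Phi> K" and p: "p \<in> K" "0 < g p"
  obtains w where "0 < g w" "cut_step\<^sup>*\<^sup>* K (convex hull (insert w X))"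
proof -
  note cD = cap_byD[OF K]
  have polyK: "polytope K" by (rule cap_by_polytope[OF K])
  note dim = cap_by_aff_dim[OF K p]
  have "X \<noteq> {}" using aff_dim_X by auto
  then obtain x where x: "x extreme_point_of X"
    using extreme_point_exists_convex[OF compact_X convex_X] by blast
  have xX: "x \<in> X" using x extreme_in_X by blast
  have xK: "x extreme_point_of K" using extreme_point_of_face[OF X_face[OF K]] x xX by blast
  obtain a b where ab: "\<And>p. g p = a \<bullet> p + b" using affine_g unfolding affine_fun_def by metis
  have "(- a) \<bullet> p < (- a) \<bullet> x" using ab[of p] ab[of x] g_X[OF xX] p by simp
  then obtain S w where S: "S face_of K" "aff_dim S = 1" "x \<in> S" "w \<in> S"
    and w: "w extreme_point_of K" "(- a) \<bullet> w < (- a) \<bullet> x"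
    using polytope_edge_descending[OF polyK xK p(1)] by metis
  have gw: "0 < g w" using ab[of w] ab[of x] g_X[OF xX] w by simp
  have w0: "g w \<noteq> 0" using gw by simp
  have wK: "w \<in> K" using w by (simp add: extreme_point_of_def)
  have props: "affine_fun f" "\<forall>p\<in>K. 0 \<le> f p" "\<exists>q\<in>X. 0 < f q"
     "\<exists>z. z extreme_point_of X \<and> f z = 0" if "f \<in> \<Phi>" for f
    using cD(2,8)[OF that] unfolding vertex_fun_def by blast+
  obtain h where h: "h \<in> \<Phi>" "h w = 0" "h x \<noteq> 0"
  proof (rule ccontr)
    assume none: "\<not> thesis"
    \<comment> \<open>If every constraint active at \<open>w\<close> were active at
      \<open>x\<close>, extremality of \<open>w\<close> would give \<open>w = x\<close>.\<close>
    have "w = x"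
    proof (rule extreme_point_active[of K "insert g \<Phi>"])
      show "K = {p. \<forall>f\<in>insert g \<Phi>. 0 \<le> f p}" by (subst cD(3)) auto
      show "affine_fun f" if "f \<in> insert g \<Phi>" for f using that affine_g props(1) by blast
      show "f x = 0" if "f \<in> insert g \<Phi>" "f w = 0" for f using that w0 none \<open>\<And>h. h \<in> \<Phi> \<Longrightarrow> h w = 0 \<Longrightarrow> h x \<noteq> 0 \<Longrightarrow> thesis\<close> by blast
    qed (use cD(1) w in auto)
    then show False using gw g_X xX by simp
  qed
  obtain y where y: "y extreme_point_of X" "h y = 0" using props(4)[OF h(1)] by blast
  have xy: "x \<noteq> y" using h y by auto
  have yX: "y \<in> X" using y extreme_in_X by blast
  have hx: "0 < h x" using props(2)[OF h(1)] h(3) cD(6) xX by (metis less_eq_real_def subsetD)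
  obtain c where ch: "chord c x y" using chord_exists[OF x y(1) xy] .
  note cd = chordD[OF ch]
  have sep2: "sep K w y x" using props[OF h(1)] h y hx unfolding sep_def by blast
  obtain F F' where F: "F facet_of K" "F' facet_of K" "F \<noteq> F'" "S \<subseteq> F" "S \<subseteq> F'"
    using edge_two_facets[OF polyK S(1,2) dim(1)] by blast
  have FX: "F \<noteq> X" "F' \<noteq> X" using F S w0 g_X by blast+
  obtain f where f: "f \<in> \<Phi>" "F = K \<inter> {p. f p = 0}"
    using facet_functional[OF K dim(2) F(1) FX(1)] by blast
  obtain f' where f': "f' \<in> \<Phi>" "F' = K \<inter> {p. f' p = 0}"
    using facet_functional[OF K dim(2) F(2) FX(2)] by blast
  have zero: "f x = 0" "f w = 0" "f' x = 0" "f' w = 0" using F S f f' by auto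
  \<comment> \<open>Both facets contain \<open>x\<close> and \<open>w\<close>; if both contained
    \<open>y\<close>, they would lie in one plane and coincide.\<close>
  have "f y \<noteq> 0 \<or> f' y \<noteq> 0"
  proof (rule ccontr)
    assume "\<not> ?thesis"
    then have fy: "f y = 0" "f' y = 0" by auto
    obtain z where z: "z \<in> X" "c z \<noteq> 0" using cd(9) by blast
    have e: "k p = k z / c z * tilt c w p" if "k \<in> \<Phi>" "k x = 0" "k y = 0" "k w = 0" for k p
      by (rule tilt_unique[OF xX yX xy cd(1,5,6) z w0 props(1)[OF that(1)] that(2,3,4)])
    have "k z / c z \<noteq> 0" if "k \<in> \<Phi>" "k x = 0" "k y = 0" "k w = 0" for k
      using e[OF that] props(3)[OF that(1)] by force
    then have "f p = 0 \<longleftrightarrow> f' p = 0" for p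
      unfolding e[OF f(1) zero(1) fy(1) zero(2), of p] e[OF f'(1) zero(3) fy(2) zero(4), of p]
      using f f' zero fy by (simp only: mult_eq_0_iff simp_thms)
    then show False using F(3) f f' by auto
  qed
  moreover have "0 \<le> f y" "0 \<le> f' y" using props(2) f f' cD(6) yX by blast+
  ultimately have "0 < f y \<or> 0 < f' y" by auto
  then have sep1: "sep K w x y" using props f f' zero unfolding sep_def by blast
  define K1 where "K1 = flat K c w"
  have s1: "cut_step\<^sup>*\<^sup>* K K1" unfolding K1_def by (rule cut_arc[OF K ch w(1) gw sep1 sep2])
  have K1K: "K1 \<subseteq> K" unfolding K1_def flat_def by blast
  have cap1: "cap_by (\<Phi> \<union> (\<lambda>l. tilt l w) ` arc_edges c) K1" unfolding K1_def by (rule cap_by_flat[OF K])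
  have wK1: "w \<in> K1" unfolding K1_def flat_def using wK tilt_self[OF w0] by simp
  \<comment> \<open>The same chord with the opposite orientation, for the other side.\<close>
  define m where "m = (\<lambda>p. - c p)"
  have ch': "chord m x y" using ch affine_fun_minus unfolding chord_def m_def by simp
  have tm: "tilt m w p = - tilt c w p" for p unfolding tilt_def m_def by simp
  define K2 where "K2 = flat K1 m w"
  have s2: "cut_step\<^sup>*\<^sup>* K1 K2" unfolding K2_def
    by (rule cut_arc[OF cap1 ch' extreme_point_of_subset[OF w(1) K1K wK1] gw
          sep_subset[OF sep1 K1K] sep_subset[OF sep2 K1K]])
  have cap2: "cap_by (\<Phi> \<union> (\<lambda>l. tilt l w) ` arc_edges c \<union> (\<lambda>l. tilt l w) ` arc_edges m) K2"
    unfolding K2_def by (rule cap_by_flat[OF cap1])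
  have K2K: "K2 \<subseteq> K" unfolding K2_def flat_def using K1K by blast
  let ?H = "convex hull (insert w X)"
  have cH: "convex ?H" and wH: "w \<in> ?H" and XH: "X \<subseteq> ?H"
    using hull_subset[of "insert w X" convex] by auto
  \<comment> \<open>Off the base, points on either side of the plane \<open>xyw\<close> lie in a
    cone over \<open>X\<close>, and points in the plane lie in the triangle
    \<open>xyw\<close>.\<close>
  have "K2 = ?H"
  proof
    have "w \<in> K2" unfolding K2_def flat_def using wK1 tilt_self[OF w0] by simp
    then show "?H \<subseteq> K2"
      using cap_byD(6)[OF cap2] polytope_imp_convex[OF cap_by_polytope[OF cap2]]
      by (intro hull_minimal) auto
    show "K2 \<subseteq> ?H"
    proof
      fix p assume p: "p \<in> K2"
      have comb: "d *\<^sub>R w + (1 - d) *\<^sub>R z \<in> ?H" if "0 < d" "d < 1" "z \<in> X" for d z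
        by (rule convexD[OF cH wH]) (use that XH in auto)
      show "p \<in> ?H"
      proof (cases "g p = 0")
        case True
        then show ?thesis using cap_byD(5)[OF cap2] p XH by blast
      next
        case False
        then have gp: "0 < g p" using cap_byD(7)[OF cap2 p] by simp
        consider "tilt c w p < 0" | "tilt m w p < 0" | "tilt c w p = 0" unfolding tm by linarith
        then show ?thesis
        proof cases
          case 1
          have "0 \<le> tilt l w p" if "l \<in> arc_edges c" for l
            using p that unfolding K2_def K1_def flat_def by blast
          then obtain d z where "0 < d" "d < 1" "z \<in> X" "p = d *\<^sub>R w + (1 - d) *\<^sub>R z"
            using cone_over_arc[OF ch gw gp 1] by metis
          then show ?thesis using comb by simp
        next
          case 2
          have "0 \<le> tilt l w p" if "l \<in> arc_edges m" for l
            using p that unfolding K2_def flat_def by blast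
          then obtain d z where "0 < d" "d < 1" "z \<in> X" "p = d *\<^sub>R w + (1 - d) *\<^sub>R z"
            using cone_over_arc[OF ch' gw gp 2] by metis
          then show ?thesis using comb by simp
        next
          case 3
          obtain r s t where r: "0 \<le> r" "0 \<le> s" "0 \<le> t" "r + s + t = (1::real)"
            "p = r *\<^sub>R x + s *\<^sub>R y + t *\<^sub>R w"
            using slice_triangle[OF ch gw cD(7) sep1 sep2 _ 3] p K2K by blast
          have "p \<in> convex hull {x, y, w}" unfolding convex_hull_3 using r by blast
          moreover have "convex hull {x, y, w} \<subseteq> ?H" using xX yX by (intro hull_mono) auto
          ultimately show ?thesis by blast
        qed
      qed
    qed
  qed
  then show thesis using that gw s1 s2 by (metis rtranclp_trans)
qed

section \<open>From cuts to the partition\<close>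

text \<open>A facet other than \<open>X\<close> is the zero face of a vertex functional; the vertex
  of \<open>X\<close> where it vanishes is a vertex of \<open>K\<close>, hence of the facet.\<close>

lemma cap_by_g_dome:
  assumes K: "cap_by \<Phi> K" and v: "v \<in> K" "0 < g v"
  shows "g_dome K X"
proof -
  note dim = cap_by_aff_dim[OF K v] and cD = cap_byD[OF K]
  have "X \<noteq> {}" using aff_dim_X by auto
  then have XK: "X facet_of K" unfolding facet_of_def using X_face[OF K] dim aff_dim_X by simp
  have "common_vertex F X" if F: "F facet_of K" "F \<noteq> X" for F
  proof -
    obtain f where f: "f \<in> \<Phi>" "F = K \<inter> {p. f p = 0}" using facet_functional[OF K dim(2) F] .
    obtain z where z: "z extreme_point_of X" "f z = 0" using cD(2)[OF f(1)] unfolding vertex_fun_def by blast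
    then have "z \<in> K" using extreme_in_X cD(6) by blast
    then have "z \<in> F" using f z by blast
    moreover have "z extreme_point_of K" using extreme_point_of_face[OF X_face[OF K]] z extreme_in_X by blast
    ultimately have "z extreme_point_of F"
      using extreme_point_of_subset facet_of_imp_subset[OF F(1)] by blast
    then show ?thesis unfolding common_vertex_def using z by blast
  qed
  then show ?thesis unfolding g_dome_def convex_polyhedron3_def
    using cap_by_polytope[OF K] dim(2) XK by blast
qed

text \<open>The section contains \<open>v\<close> and an edge of \<open>X\<close> but not
  \<open>w\<close>, so it is a polygon. The piece meets the base plane exactly in that edge because
  \<open>l\<close> is nonnegative on \<open>X\<close>.\<close>

lemma cut_stepE:
  assumes K: "cap_by \<Phi> K" and step: "cut_step K K'"
  obtains h \<Phi>' q where "affine_fun h" "h q \<noteq> 0" "K' = K \<inter> {p. 0 \<le> h p}" "cap_by \<Phi>' K'"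
    "pyramid (K \<inter> {p. h p \<le> 0})" "common_edge (K \<inter> {p. h p \<le> 0}) X"
proof -
  note cD = cap_byD[OF K]
  obtain l v w where l: "l \<in> L" and v: "v \<in> K" "0 < g v" and w: "w \<in> K" "tilt l v w < 0"
    and P: "K \<inter> {p. tilt l v p \<le> 0} = convex hull (insert w (K \<inter> {p. tilt l v p = 0}))"
    and K': "K' = K \<inter> {p. 0 \<le> tilt l v p}"
    using step unfolding cut_step_def by blast
  define h where "h = tilt l v"
  have h: "affine_fun h" unfolding h_def by (rule affine_tilt[OF affine_L[OF l]])
  have hX: "h q = l q" if "q \<in> X" for q unfolding h_def using that by (simp add: tilt_base g_X)
  define B where "B = K \<inter> {p. h p = 0}"
  have wB: "w \<notin> affine hull B"
    using affine_fun_zero_affine_hull[OF h, of B w] w unfolding B_def h_def by auto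
  have "aff_dim B = 2"
  proof -
    have "aff_dim (insert w B) = aff_dim B + 1" using wB by (simp add: aff_dim_insert)
    moreover have "aff_dim (insert w B) \<le> 3" using aff_dim_le_DIM[of "insert w B"] by simp
    ultimately have "aff_dim B \<le> 2" by linarith
    moreover have "2 \<le> aff_dim B"
    proof -
      obtain a b where ab: "a \<in> X" "b \<in> X" "a \<noteq> b" "l a = 0" "l b = 0" using edge_two_points[OF l] by blast
      have "v \<notin> affine hull {a, b}"
        using affine_fun_zero_affine_hull[OF affine_g, of "{a, b}" v] g_X ab v by auto
      then have "aff_dim (insert v {a, b}) = 2" using ab by (simp add: aff_dim_insert aff_dim_2)
      moreover have "insert v {a, b} \<subseteq> B"
        using ab v cD(6) hX tilt_self[of v l] unfolding B_def by (auto simp: h_def)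
      ultimately show ?thesis by (metis aff_dim_subset)
    qed
    ultimately show ?thesis by simp
  qed
  moreover have "polytope B" unfolding B_def
    by (rule polytope_Int_polyhedron[OF cap_by_polytope[OF K] affine_fun_level(3)[OF h]])
  ultimately have pyr: "pyramid (K \<inter> {p. h p \<le> 0})"
    unfolding pyramid_def pyramid_with_base_def convex_polygon_def
    using wB P unfolding B_def h_def by blast
  have convP: "convex (K \<inter> {p. h p \<le> 0})"
    by (intro convex_Int polytope_imp_convex[OF cap_by_polytope[OF K]] affine_fun_level_convex(2)[OF h])
  have "(K \<inter> {p. h p \<le> 0}) \<inter> {p. g p = 0} = X \<inter> {p. h p \<le> 0}" using cD(5) by blast
  also have "\<dots> = X \<inter> {q. l q = 0}" using hX L_nonneg[OF l] by force
  finally have "(X \<inter> {q. l q = 0}) face_of (K \<inter> {p. h p \<le> 0})"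
    using affine_fun_face[OF affine_g convP] cD(7) by force
  then have ce: "common_edge (K \<inter> {p. h p \<le> 0}) X"
    using edge_L[OF l] unfolding common_edge_def edge_of_def by blast
  have "K' = K \<inter> {p. \<forall>f\<in>{h}. 0 \<le> f p}" unfolding K' h_def by simp
  then have cap': "cap_by (\<Phi> \<union> {h}) K'"
    using cap_by_cut[OF K, of "{h}"] vertex_fun_tilt[OF l] unfolding h_def by simp
  show thesis
    by (rule that[OF h _ _ cap' pyr ce, of w]) (use w K' h_def in auto)
qed

lemma cap_by_partition:
  assumes G: "cap_by \<Phi> G" and p: "p \<in> G" "0 < g p"
  shows "\<exists>(n::nat) (P :: nat \<Rightarrow> (real^3) set).
           n \<ge> 1 \<and>
           partition_into_pyramids G n P \<and>
           (\<forall>i\<in>{1..n}. common_edge (P i) X) \<and>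
           (\<forall>j\<in>{1..n-1}. g_dome (closure (G - (\<Union>i\<in>{1..j}. P i))) X) \<and>
           pyramid_with_base (P n) X"
proof -
  obtain w where w: "0 < g w" "cut_step\<^sup>*\<^sup>* G (convex hull (insert w X))"
    using cap_reaches_pyramid[OF G p] .
  let ?H = "convex hull (insert w X)"
  obtain r where "(cut_step ^^ r) G ?H" using rtranclp_imp_relpowp[OF w(2)] by blast
  then obtain f where f: "f 0 = G" "f r = ?H" "\<And>i. i < r \<Longrightarrow> cut_step (f i) (f (Suc i))"
    unfolding relpowp_fun_conv by blast
  have caps: "\<exists>\<Phi>. cap_by \<Phi> (f i)" if "i \<le> r" for i
    using that
  proof (induction i)
    case 0
    then show ?case using f(1) G by auto
  next
    case (Suc i)
    then obtain \<Psi> where "cap_by \<Psi> (f i)" by auto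
    then show ?case using cut_stepE[OF _ f(3)[of i]] Suc.prems by (metis Suc_le_lessD)
  qed
  define cut where "cut = (\<lambda>i h. affine_fun h \<and> (\<exists>q. h q \<noteq> 0) \<and> f (Suc i) = f i \<inter> {p. 0 \<le> h p} \<and>
     pyramid (f i \<inter> {p. h p \<le> 0}) \<and> common_edge (f i \<inter> {p. h p \<le> 0}) X)"
  have "\<forall>i\<in>{..<r}. \<exists>h. cut i h"
  proof
    fix i assume "i \<in> {..<r}"
    then have i: "i < r" by simp
    obtain \<Psi> where "cap_by \<Psi> (f i)" using caps[of i] i by auto
    from cut_stepE[OF this f(3)[OF i]] show "\<exists>h. cut i h" unfolding cut_def by metis
  qed
  from bchoice[OF this] obtain h where "\<forall>i\<in>{..<r}. cut i (h i)" by blast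
  then have h: "affine_fun (h i)" "\<exists>q. h i q \<noteq> 0" "f (Suc i) = f i \<inter> {p. 0 \<le> h i p}"
    "pyramid (f i \<inter> {p. h i p \<le> 0})" "common_edge (f i \<inter> {p. h i p \<le> 0}) X" if "i < r" for i
    using that unfolding cut_def by simp_all
  \<comment> \<open>With \<open>r\<close> cuts there are \<open>r + 1\<close> pyramids:
    \<open>P i\<close> is cut from stage \<open>i - 1\<close>, and index \<open>r + 1\<close> takes
    the default, the pyramid over \<open>X\<close>.\<close>
  define P where "P = (\<lambda>i. if i \<le> r then f (i - 1) \<inter> {p. h (i - 1) p \<le> 0} else ?H)"
  have mono: "f j \<subseteq> f i" if "i \<le> j" "j \<le> r" for i j
    using that
  proof (induction j rule: dec_induct)
    case (step j)
    then show ?case using h(3)[of j] by auto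
  qed simp
  have above: "0 \<le> h i p" if "i < j" "j \<le> r" "p \<in> f j" for i j p
    using mono[of "Suc i" j] h(3)[of i] that by auto
  \<comment> \<open>The apex of the last pyramid lies in every stage, which makes every stage
    solid.\<close>
  have wH: "w \<in> f j" if "j \<le> r" for j
    using mono[OF that order_refl] f(2) hull_subset[of "insert w X" convex] by auto
  have intf: "interior (f j) \<noteq> {}" if "j \<le> r" for j
    using caps[OF that] cap_by_aff_dim(2) wH[OF that] w(1) by blast
  have Psub: "P i \<subseteq> f (i - 1)" if "i \<in> {1..r+1}" for i
    using that f(2) unfolding P_def by (cases "i \<le> r") (auto simp: le_Suc_eq)
  have wX: "w \<notin> affine hull X"
    using affine_fun_zero_affine_hull[OF affine_g, of X w] g_X w by auto
  have base: "pyramid_with_base ?H X"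
    unfolding pyramid_with_base_def convex_polygon_def using polytope_X aff_dim_X wX by blast
  have cover: "G \<subseteq> (\<Union>i\<in>{1..j}. P i) \<union> f j" if "j \<le> r" for j
    using that
  proof (induction j)
    case 0
    then show ?case using f(1) by simp
  next
    case (Suc j)
    have Pj: "P (Suc j) = f j \<inter> {p. h j p \<le> 0}" using Suc.prems unfolding P_def by simp
    have fj: "f (Suc j) = f j \<inter> {p. 0 \<le> h j p}" using h(3)[of j] Suc.prems by simp
    have "f j \<subseteq> P (Suc j) \<union> f (Suc j)" unfolding Pj fj by auto
    moreover have "G \<subseteq> (\<Union>i\<in>{1..j}. P i) \<union> f j" using Suc by simp
    moreover have "(\<Union>i\<in>{1..Suc j}. P i) = (\<Union>i\<in>{1..j}. P i) \<union> P (Suc j)"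
      by (simp add: atLeastAtMostSuc_conv Un_commute)
    ultimately show ?case by blast
  qed
  have Pr: "P (r + 1) = f r" unfolding P_def using f(2) by simp
  have fG: "f i \<subseteq> G" if "i \<le> r" for i using mono[OF _ that, of 0] f(1) by simp
  have union: "G = (\<Union>i\<in>{1..r+1}. P i)"
  proof
    have "(\<Union>i\<in>{1..r}. P i) \<union> P (r + 1) \<subseteq> (\<Union>i\<in>{1..r+1}. P i)" by (intro Un_least UN_mono UN_upper) auto
    then show "G \<subseteq> (\<Union>i\<in>{1..r+1}. P i)" using cover[OF order_refl] unfolding Pr by blast
    show "(\<Union>i\<in>{1..r+1}. P i) \<subseteq> G"
    proof (rule UN_least)
      fix i assume i: "i \<in> {1..r+1}"
      then have "i - 1 \<le> r" by auto
      then show "P i \<subseteq> G" using Psub[OF i] fG by blast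
    qed
  qed
  \<comment> \<open>On the interior of \<open>P i\<close> the functional \<open>h (i - 1)\<close> is
    negative; on all later stages it is nonnegative.\<close>
  have disj: "interior (P i) \<inter> interior (P j) = {}" if "i \<in> {1..r+1}" "j \<in> {1..r+1}" "i < j" for i j
  proof -
    have i: "i - 1 < r" "i \<le> r" using that by auto
    have "h (i - 1) p < 0" if "p \<in> interior (P i)" for p
    proof -
      obtain q where "h (i - 1) q \<noteq> 0" using h(2)[OF i(1)] by blast
      then have "0 < - h (i - 1) p"
        using affine_fun_interior_pos[OF affine_fun_minus[OF h(1)[OF i(1)]], of "P i" q p] that i(2)
        unfolding P_def by auto
      then show ?thesis by simp
    qed
    moreover have "0 \<le> h (i - 1) p" if p: "p \<in> interior (P j)" for p
    proof (rule above)
      show "i - 1 < j - 1" "j - 1 \<le> r" using \<open>i \<in> {1..r+1}\<close> \<open>j \<in> {1..r+1}\<close> \<open>i < j\<close> by auto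
      have "p \<in> P j" using p interior_subset by blast
      then show "p \<in> f (j - 1)" using Psub[OF \<open>j \<in> {1..r+1}\<close>] by blast
    qed
    ultimately show ?thesis by force
  qed
  have "interior (P i) \<inter> interior (P j) = {}" if "i \<in> {1..r+1}" "j \<in> {1..r+1}" "i \<noteq> j" for i j
    using disj[of i j] disj[of j i] that by (metis Int_commute linorder_neqE_nat)
  moreover have "pyramid (P i)" if "i \<in> {1..r+1}" for i
    using h(4)[of "i - 1"] base that unfolding P_def pyramid_def by auto
  ultimately have part: "partition_into_pyramids G (r + 1) P"
    unfolding partition_into_pyramids_def using union by blast
  \<comment> \<open>The last pyramid has all of \<open>X\<close> as a face, so any edge of
    \<open>X\<close> is a common edge.\<close>
  obtain e where e: "e facet_of X" using polytope_facet_exists[OF polytope_X] aff_dim_X by auto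
  have eX: "e face_of X" "aff_dim e = 1" using e aff_dim_X unfolding facet_of_def by auto
  obtain \<Psi> where "cap_by \<Psi> ?H" using caps[of r] f(2) by auto
  then have "e face_of ?H" using X_face face_of_trans[OF eX(1)] by blast
  then have "common_edge ?H X" unfolding common_edge_def edge_of_def using eX by blast
  then have edges: "common_edge (P i) X" if "i \<in> {1..r+1}" for i
    using h(5)[of "i - 1"] that unfolding P_def by auto
  have domes: "g_dome (closure (G - (\<Union>i\<in>{1..j}. P i))) X" if j: "j \<in> {1..r}" for j
  proof -
    have jr: "j \<le> r" using j by simp
    obtain \<Psi> where capj: "cap_by \<Psi> (f j)" using caps[OF jr] by blast
    let ?D = "G - (\<Union>i\<in>{1..j}. P i)"
    \<comment> \<open>The difference lies between the interior of \<open>f j\<close> and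
      \<open>f j\<close>; since \<open>f j\<close> is closed and convex with nonempty interior, the
      closure is \<open>f j\<close>.\<close>
    have "?D \<subseteq> f j" using cover[OF jr] by blast
    moreover have "interior (f j) \<subseteq> ?D"
    proof
      fix p assume p: "p \<in> interior (f j)"
      then have "p \<in> f j" using interior_subset by blast
      then have "p \<in> G" using mono[of 0 j] f(1) jr by auto
      moreover have "p \<notin> P i" if i: "i \<in> {1..j}" for i
      proof -
        have ir: "i - 1 < r" "i - 1 < j" "i \<le> r" using i jr by auto
        obtain q where "h (i - 1) q \<noteq> 0" using h(2)[OF ir(1)] by blast
        then have "0 < h (i - 1) p"
          using affine_fun_interior_pos[OF h(1)[OF ir(1)] above[OF ir(2) jr] _ p] by blast
        then show ?thesis using ir unfolding P_def by auto
      qed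
      ultimately show "p \<in> ?D" by blast
    qed
    moreover have "closed (f j)" "convex (f j)"
      using cap_by_polytope[OF capj] polytope_imp_closed polytope_imp_convex by blast+
    moreover have "closure (interior (f j)) = closure (f j)"
      by (rule convex_closure_interior[OF \<open>convex (f j)\<close> intf[OF jr]])
    ultimately have "closure ?D = f j"
      by (metis closure_closed closure_mono subset_antisym)
    then show ?thesis using cap_by_g_dome[OF capj wH[OF jr] w(1)] by simp
  qed
  have "P (r + 1) = ?H" unfolding P_def by simp
  then show ?thesis
    using part edges domes base by (intro exI[of _ "r + 1"] exI[of _ P]) auto
qed

end

section \<open>Half-space form of a g-dome\<close>

lemma polyhedron_facet_functional:
  fixes S :: "(real^3) set"
  assumes "polyhedron S" "F facet_of S"
  shows "\<exists>f. affine_fun f \<and> (\<forall>p\<in>S. 0 \<le> f p) \<and> F = S \<inter> {p. f p = 0}"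
proof -
  obtain a b where ab: "S \<subseteq> {x. a \<bullet> x \<le> b}" "F = S \<inter> {x. a \<bullet> x = b}"
    using facet_of_polyhedron[OF assms] by metis
  define f where "f = (\<lambda>p. (- a) \<bullet> p + b)"
  have "affine_fun f" unfolding affine_fun_def f_def by blast
  then show ?thesis using ab by (intro exI[of _ f]) (auto simp: f_def)
qed

text \<open>Otherwise the segment from a relative interior point to \<open>p\<close> would leave
  \<open>S\<close> through a facet \<open>F\<close> before \<open>p\<close>, although
  \<open>f F\<close> is positive at the start and nonnegative at \<open>p\<close>.\<close>

lemma mem_polytope_if_facet_functionals_nonneg:
  fixes S :: "(real^3) set"
  assumes S: "polytope S" "S \<noteq> {}"
    and f: "\<And>F. F facet_of S \<Longrightarrow> affine_fun (f F) \<and> (\<forall>p\<in>S. 0 \<le> f F p) \<and> F = S \<inter> {p. f F p = 0}"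
    and p: "p \<in> affine hull S" "\<And>F. F facet_of S \<Longrightarrow> 0 \<le> f F p"
  shows "p \<in> S"
proof (rule ccontr)
  assume pS: "p \<notin> S"
  have polyS: "polyhedron S" using S polytope_imp_polyhedron by blast
  have "convex S" "closed S" "bounded S"
    using S polytope_imp_convex polytope_imp_closed polytope_imp_bounded by blast+
  obtain i where i: "i \<in> rel_interior S" using S \<open>convex S\<close> rel_interior_eq_empty by blast
  have iS: "i \<in> S" using i rel_interior_subset by blast
  have "p - i \<noteq> 0" using iS pS by auto
  moreover have "i + (p - i) \<in> affine hull S" using p by simp
  ultimately obtain d where d: "0 < d" "i + d *\<^sub>R (p - i) \<in> rel_frontier S"
    "\<And>e. 0 \<le> e \<Longrightarrow> e < d \<Longrightarrow> i + e *\<^sub>R (p - i) \<in> rel_interior S"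
    using ray_to_rel_frontier[OF \<open>bounded S\<close> i] by blast
  have fr: "rel_frontier S \<subseteq> S" using \<open>closed S\<close> unfolding rel_frontier_def by auto
  have "d < 1"
  proof (rule ccontr)
    assume "\<not> d < 1"
    then consider "d = 1" | "1 < d" by linarith
    then show False
    proof cases
      case 1
      then show False using d(2) fr pS by auto
    next
      case 2
      then show False using d(3)[of 1] rel_interior_subset pS by auto
    qed
  qed
  obtain F where F: "F facet_of S" "i + d *\<^sub>R (p - i) \<in> F"
    using d(2) rel_frontier_of_polyhedron[OF polyS] by blast
  note fF = f[OF F(1)]
  have "i \<notin> F" using F(1) i rel_frontier_of_polyhedron[OF polyS] unfolding rel_frontier_def by blast
  then have "0 < f F i" using fF iS by (metis (mono_tags, lifting) IntI less_eq_real_def mem_Collect_eq)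
  then have "0 < (1 - d) * f F i + d * f F p"
    using \<open>d < 1\<close> d(1) p(2)[OF F(1)] by (simp add: add_pos_nonneg)
  moreover have "f F (i + d *\<^sub>R (p - i)) = f F i + d * (f F p - f F i)"
    using affine_fun_diff_point fF by blast
  moreover have "f F (i + d *\<^sub>R (p - i)) = 0" using fF F(2) by blast
  ultimately show False by (simp add: algebra_simps)
qed

theorem theorem3p2:
  fixes G X :: "(real^3) set"
  assumes "g_dome G X"
  shows "\<exists>(n::nat) (P :: nat \<Rightarrow> (real^3) set).
           n \<ge> 1 \<and>
           partition_into_pyramids G n P \<and>
           (\<forall>i\<in>{1..n}. common_edge (P i) X) \<and>
           (\<forall>j\<in>{1..n-1}. g_dome (closure (G - (\<Union>i\<in>{1..j}. P i))) X) \<and>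
           pyramid_with_base (P n) X"
proof -
  have polyG: "polytope G" and intG: "interior G \<noteq> {}" and XG: "X facet_of G"
    and dome: "\<And>F. F facet_of G \<Longrightarrow> F \<noteq> X \<Longrightarrow> common_edge F X \<or> common_vertex F X"
    using assms unfolding g_dome_def convex_polyhedron3_def by auto
  have hedG: "polyhedron G" and convG: "convex G"
    using polyG polytope_imp_polyhedron polytope_imp_convex by blast+
  have Xf: "X face_of G" using XG facet_of_imp_face_of by blast
  have polyX: "polytope X" using face_of_polytope_polytope[OF polyG Xf] .
  have dimG: "aff_dim G = 3" using aff_dim_nonempty_interior[OF intG] by simp
  have dimX: "aff_dim X = 2" using XG dimG unfolding facet_of_def by simp
  have Xne: "X \<noteq> {}" using dimX by auto
  obtain \<phi> where \<phi>: "\<And>F. F facet_of G \<Longrightarrow>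
      affine_fun (\<phi> F) \<and> (\<forall>p\<in>G. 0 \<le> \<phi> F p) \<and> F = G \<inter> {p. \<phi> F p = 0}"
    using polyhedron_facet_functional[OF hedG] by metis
  obtain \<mu> where \<mu>: "\<And>F. F facet_of X \<Longrightarrow>
      affine_fun (\<mu> F) \<and> (\<forall>p\<in>X. 0 \<le> \<mu> F p) \<and> F = X \<inter> {p. \<mu> F p = 0}"
    using polyhedron_facet_functional[OF polytope_imp_polyhedron[OF polyX]] by metis
  define g where "g = \<phi> X"
  define L where "L = \<mu> ` {F. F facet_of X}"
  define \<Phi> where "\<Phi> = \<phi> ` {F. F facet_of G \<and> F \<noteq> X}"
  have g: "affine_fun g" "\<And>p. p \<in> G \<Longrightarrow> 0 \<le> g p" "X = G \<inter> {p. g p = 0}"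
    using \<phi>[OF XG] unfolding g_def by auto
  have "G \<noteq> X" using XG facet_of_irrefl by blast
  then obtain p where p: "p \<in> G" "g p \<noteq> 0" using g(3) by blast
  then have gp: "0 < g p" using g(2) by force
  \<comment> \<open>The edge functionals characterise \<open>X\<close> only within its affine hull,
    which is therefore identified with the base plane.\<close>
  have hullX: "affine hull X = {p. g p = 0}"
  proof (rule affine_dim_equal)
    show "affine hull X \<subseteq> {p. g p = 0}"
      by (rule hull_minimal) (use g affine_fun_level(4) in auto)
    moreover have "aff_dim {p. g p = 0} \<le> 2"
    proof -
      have "p \<notin> affine hull {p. g p = 0}"
        using affine_fun_zero_affine_hull[OF g(1), of "{p. g p = 0}" p] p by auto
      then have "aff_dim (insert p {p. g p = 0}) = aff_dim {p. g p = 0} + 1"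
        by (simp add: aff_dim_insert)
      moreover have "aff_dim (insert p {p. g p = 0}) \<le> 3"
        using aff_dim_le_DIM[of "insert p {p. g p = 0}"] by simp
      ultimately show ?thesis by linarith
    qed
    ultimately show "aff_dim (affine hull X) = aff_dim {p. g p = 0}"
      using aff_dim_subset dimX by (metis aff_dim_affine_hull order_antisym)
  qed (use g affine_fun_level(4) Xne in auto)
  interpret dome_base X g L
  proof
    show "affine_fun g" by (rule g(1))
    show "\<exists>p. 0 < g p" using gp by blast
    show "polytope X" "aff_dim X = 2" by fact+
    show "finite L" unfolding L_def using finite_polytope_facets[OF polyX] by simp
    show "affine_fun l" if "l \<in> L" for l using that \<mu> unfolding L_def by blast
    show "X = {q. g q = 0 \<and> (\<forall>l\<in>L. 0 \<le> l q)}"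
    proof
      show "X \<subseteq> {q. g q = 0 \<and> (\<forall>l\<in>L. 0 \<le> l q)}" using g(3) \<mu> unfolding L_def by blast
      show "{q. g q = 0 \<and> (\<forall>l\<in>L. 0 \<le> l q)} \<subseteq> X"
      proof
        fix q assume "q \<in> {q. g q = 0 \<and> (\<forall>l\<in>L. 0 \<le> l q)}"
        then show "q \<in> X"
          using mem_polytope_if_facet_functionals_nonneg[OF polyX Xne \<mu>] hullX unfolding L_def by blast
      qed
    qed
    show "(X \<inter> {q. l q = 0}) edge_of X" and "\<exists>q\<in>X. 0 < l q" if l: "l \<in> L" for l
    proof -
      obtain F where F: "F facet_of X" "l = \<mu> F" using l unfolding L_def by blast
      have FX: "F = X \<inter> {q. l q = 0}" "\<forall>p\<in>X. 0 \<le> l p" using \<mu>[OF F(1)] F(2) by auto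
      show "(X \<inter> {q. l q = 0}) edge_of X"
        using F dimX unfolding FX(1)[symmetric] facet_of_def edge_of_def by simp
      have "F \<noteq> X" using F facet_of_irrefl by blast
      then show "\<exists>q\<in>X. 0 < l q" using FX by (metis (mono_tags, lifting) Int_absorb2 less_eq_real_def mem_Collect_eq subsetI)
    qed
  qed
  have "vertex_fun f" if "f \<in> \<Phi>" for f
  proof -
    obtain F where F: "F facet_of G" "F \<noteq> X" "f = \<phi> F" using \<open>f \<in> \<Phi>\<close> unfolding \<Phi>_def by blast
    have f: "affine_fun f" "\<forall>p\<in>G. 0 \<le> f p" "F = G \<inter> {p. f p = 0}" using \<phi>[OF F(1)] F(3) by auto
    have XsubG: "X \<subseteq> G" using g(3) by blast
    \<comment> \<open>A common edge is compact and convex, so it has an extreme point, which is a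
      vertex of \<open>X\<close>.\<close>
    have "\<exists>z. z extreme_point_of X \<and> z \<in> F"
      using dome[OF F(1,2)]
    proof
      assume "common_vertex F X"
      then show ?thesis unfolding common_vertex_def extreme_point_of_def by blast
    next
      assume "common_edge F X"
      then obtain e where e: "e edge_of F" "e edge_of X" unfolding common_edge_def by blast
      have eX: "e face_of X" "e \<noteq> {}" using e(2) unfolding edge_of_def by auto
      have "compact e" "convex e"
        using eX polyX face_of_polytope_polytope polytope_imp_compact polytope_imp_convex by blast+
      then obtain z where "z extreme_point_of e" using extreme_point_exists_convex eX(2) by blast
      then have "z extreme_point_of X" "z \<in> e"
        using extreme_point_of_face[OF eX(1)] by blast+
      then show ?thesis using e(1) edge_of_imp_subset by blast
    qed
    then have "\<exists>z. z extreme_point_of X \<and> f z = 0" using f(3) by blast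
    \<comment> \<open>Otherwise \<open>X\<close> would be a face of \<open>F\<close> of the same
      dimension, hence equal to \<open>F\<close>.\<close>
    moreover have "\<exists>q\<in>X. 0 < f q"
    proof (rule ccontr)
      assume "\<not> ?thesis"
      then have "\<forall>q\<in>X. f q = 0" using f(2) XsubG by (metis less_eq_real_def subsetD)
      then have "X \<subseteq> F" using f(3) XsubG by blast
      then have "X face_of F" using Xf F(1) by (meson face_of_face facet_of_imp_face_of)
      moreover have "aff_dim X = aff_dim F" using XG F(1) unfolding facet_of_def by simp
      moreover have "convex F" using F(1) facet_of_imp_face_of face_of_imp_convex by blast
      ultimately show False using face_of_aff_dim_lt[of F X] F(2) by force
    qed
    ultimately show ?thesis unfolding vertex_fun_def using f XsubG by blast
  qed
  moreover have "G = {p. 0 \<le> g p \<and> (\<forall>f\<in>\<Phi>. 0 \<le> f p)}"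
  proof
    show "G \<subseteq> {p. 0 \<le> g p \<and> (\<forall>f\<in>\<Phi>. 0 \<le> f p)}" using g(2) \<phi> unfolding \<Phi>_def by blast
    show "{p. 0 \<le> g p \<and> (\<forall>f\<in>\<Phi>. 0 \<le> f p)} \<subseteq> G"
    proof
      fix q assume q: "q \<in> {p. 0 \<le> g p \<and> (\<forall>f\<in>\<Phi>. 0 \<le> f p)}"
      have "q \<in> affine hull G" using affine_hull_nonempty_interior[OF intG] by simp
      moreover have "0 \<le> \<phi> F q" if "F facet_of G" for F
        using q that unfolding g_def \<Phi>_def by (cases "F = X") auto
      ultimately show "q \<in> G"
        using mem_polytope_if_facet_functionals_nonneg[OF polyG _ \<phi>] p(1) by blast
    qed
  qed
  moreover have "finite \<Phi>" unfolding \<Phi>_def using finite_polytope_facets[OF polyG] by simp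
  ultimately have "cap_by \<Phi> G"
    unfolding cap_by_def using g(3) polytope_imp_bounded[OF polyG] by blast
  then show ?thesis using cap_by_partition p(1) gp by blast
qed

end
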